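(* Let $\Gamma=(X,\mathcal E)$ be the Petersen graph (the distance-regular graph with $10$ vertices and intersection array $\{3,2;1,1\}$); the spectrum of its adjacency matrix $A$ is $3^11^5(-2)^4$. Let $x\in X$ and $T=T(x)$. Order the three vertices of $\Gamma_1(x)$ arbitrarily, and order $\Gamma_2(x)$ as $y_1,\dots,y_6$ so that each of the pairs $\{y_1,y_2\},\{y_3,y_4\},\{y_5,y_6\}$ has a common neighbor in $\Gamma_1(x)$, and the subgraph induced on $\Gamma_2(x)$ is the 6-cycle $y_1,y_3,y_5,y_2,y_4,y_6$ (in this cyclic order). Then the standard module $V=\mathbb C^X$ is an orthogonal direct sum of irreducible $T$-modules $V=W_0\oplus W_{1,a}\oplus W_{1,b}\oplus W_{2,a}\oplus W_{2,b}\oplus W_{2,c}$, where two summands are isomorphic if and only if they have the same type in the following list, and the data are as listed. Each listed basis is a pure basis of the module. For each summand other than $W_0$, the seed vector $\nu$ spans $E_r^*W$ (so $\dim E_r^*W=1$), where $r$ is the endpoint of the summand $W$, and is given by its essential part. Type I ($W_0$): endpoint 0, multiplicity 1, dimension 3, diameter 2, shape $(1,1,1)$; basis $e_0^*,e_1^*,e_2^*$; matrix representing $A$: $\begin{pmatrix}0&3&0\\1&0&2\\0&1&2\end{pmatrix}$, with eigenvalues $3,1,-2$. Type II ($W_{1,a},W_{1,b}$): endpoint 1, multiplicity 2, dimension 2, diameter 1, shape $(1,1)$; basis $\nu,A\nu$ (with $A\nu=E_2^*A\nu$), where $\nu=[1,-1,0]$ for $W_{1,a}$ and $\nu=[1,1,-2]$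 for $W_{1,b}$; matrix representing $A$: $\begin{pmatrix}0&2\\1&-1\end{pmatrix}$, with eigenvalues $1,-2$. Type III ($W_{2,a},W_{2,b}$): endpoint 2, multiplicity 2, dimension 1, diameter 0, shape $(1)$; basis $\nu$, where $\nu=[1,-1,1,-1,0,0]$ for $W_{2,a}$ and $\nu=[1,-1,-1,1,-2,2]$ for $W_{2,b}$; matrix representing $A$: $\begin{pmatrix}1\end{pmatrix}$, with eigenvalue $1$. Type IV ($W_{2,c}$): endpoint 2, multiplicity 1, dimension 1, diameter 0, shape $(1)$; basis $\nu$, where $\nu=[1,-1,-1,1,1,-1]$; matrix representing $A$: $\begin{pmatrix}-2\end{pmatrix}$, with eigenvalue $-2$. Moreover $\dim T=3^2+2^2+1^2+1^2=15$.
   Context: Let $\Gamma=(X,\mathcal E)$ be a finite undirected connected graph without loops or multiple edges, with path-length distance $d$ and diameter $D\ge1$; put $\Gamma_i(x)=\{y\in X:d(x,y)=i\}$. $\Gamma$ is distance-regular if for all $0\le h,i,j\le D$ the number $p^h_{i,j}=|\Gamma_i(y)\cap\Gamma_j(z)|$ is the same for all $y,z\in X$ with $d(y,z)=h$. Its intersection array is $\{b_0,\dots,b_{D-1};c_1,\dots,c_D\}$ with $b_i=p^i_{1,i+1}$, $c_i=p^i_{1,i-1}$. $A\in\mathrm{Mat}_X(\mathbb C)$ is the adjacency matrix; in its spectrum, exponents denote multiplicities. The standard module $V=\mathbb C^X$ (column vectors) carries the Hermitian inner product $\langle u,v\rangle=u^t\bar v$. Fix a base vertex $x\in X$. For $0\le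 i\le D$, $E_i^*=E_i^*(x)$ is the diagonal matrix with $(y,y)$-entry $1$ if $d(x,y)=i$ and $0$ otherwise, and $e_i^*\in V$ is the vector with $y$-entry $1$ if $d(x,y)=i$ and $0$ otherwise. The Terwilliger algebra $T=T(x)$ is the subalgebra of $\mathrm{Mat}_X(\mathbb C)$ generated by $A$ and $E_0^*,\dots,E_D^*$. A $T$-module is a subspace $W\subseteq V$ with $BW\subseteq W$ for all $B\in T$; it is irreducible if $W\ne0$ and it properly contains no nonzero $T$-module. Isomorphisms of $T$-modules are vector space isomorphisms commuting with every $B\in T$. The endpoint of $W$ is $r=\min\{i:E_i^*W\ne0\}$; the diameter of an irreducible $W$ is $\delta=|\{i:E_i^*W\ne0\}|-1$, and its shape is $(\dim E_r^*W,\dots,\dim E_{r+\delta}^*W)$. The multiplicity of an irreducible module is the number of summands isomorphic to it in an orthogonal decomposition of $V$ into irreducible $T$-modules. A nonzero vector is pure with support $i$ if it lies in $E_i^*V$; its essential part is the row vector of its coordinates at the vertices of $\Gamma_i(x)$, in the chosen order (all its other coordinates are $0$). A pure basis of an irreducible $T$-module is an ordered basis of pure vectors with weakly increasing supports. The matrix $B$ representing $A$ with respect to a basis $v_1,\dots,v_\ell$ is given by $Av_j=\sum_iB_{ij}v_i$. *)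

theory Defs
  imports "Jordan_Normal_Form.Char_Poly" "HOL-Analysis.Analysis"
begin

no_notation vec_index (infixl "$" 100)

section \<open>Distance-regular graphs\<close>

text \<open>The vertex set is the whole finite type; an edge set is a symmetric irreflexive relation.\<close>

definition connected_graph :: "('v::finite \<Rightarrow> 'v \<Rightarrow> bool) \<Rightarrow> bool" where
  "connected_graph adj \<longleftrightarrow> symp adj \<and> irreflp adj \<and> (\<forall>y z. adj\<^sup>*\<^sup>* y z)"

definition gdist :: "('v::finite \<Rightarrow> 'v \<Rightarrow> bool) \<Rightarrow> 'v \<Rightarrow> 'v \<Rightarrow> nat" where
  "gdist adj y z = (LEAST n. (adj ^^ n) y z)"

definition gdiam :: "('v::finite \<Rightarrow> 'v \<Rightarrow> bool) \<Rightarrow> nat" where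
  "gdiam adj = Max {gdist adj y z | y z. True}"

definition sphere_at :: "('v::finite \<Rightarrow> 'v \<Rightarrow> bool) \<Rightarrow> nat \<Rightarrow> 'v \<Rightarrow> 'v set" where
  "sphere_at adj i y = {z. gdist adj y z = i}"

definition distance_regular :: "('v::finite \<Rightarrow> 'v \<Rightarrow> bool) \<Rightarrow> bool" where
  "distance_regular adj \<longleftrightarrow> connected_graph adj \<and> gdiam adj \<ge> 1 \<and>
     (\<forall>h\<le>gdiam adj. \<forall>i\<le>gdiam adj. \<forall>j\<le>gdiam adj. \<exists>p. \<forall>y z. gdist adj y z = h \<longrightarrow>
        card (sphere_at adj i y \<inter> sphere_at adj j z) = p)"

text \<open>\<open>intersection_number adj h i j\<close> is the number usually written $p^h_{i,j}$.\<close>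

definition intersection_number ::
    "('v::finite \<Rightarrow> 'v \<Rightarrow> bool) \<Rightarrow> nat \<Rightarrow> nat \<Rightarrow> nat \<Rightarrow> nat" where
  "intersection_number adj h i j = (THE p. \<forall>y z. gdist adj y z = h \<longrightarrow>
     card (sphere_at adj i y \<inter> sphere_at adj j z) = p)"

definition intersection_array :: "('v::finite \<Rightarrow> 'v \<Rightarrow> bool) \<Rightarrow> nat list \<times> nat list" where
  "intersection_array adj =
     (map (\<lambda>i. intersection_number adj i 1 (i + 1)) [0..<gdiam adj],
      map (\<lambda>i. intersection_number adj i 1 (i - 1)) [1..<gdiam adj + 1])"

definition petersen :: "('v::finite \<Rightarrow> 'v \<Rightarrow> bool) \<Rightarrow> bool" where
  "petersen adj \<longleftrightarrow> distance_regular adj \<and> CARD('v) = 10 \<and>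
     intersection_array adj = ([3, 2], [1, 1])"

text \<open>The subgraph induced on \<open>set cs\<close> is the cycle visiting \<open>cs\<close> in the given cyclic order.\<close>

definition induces_cycle :: "('v::finite \<Rightarrow> 'v \<Rightarrow> bool) \<Rightarrow> 'v list \<Rightarrow> bool" where
  "induces_cycle adj cs \<longleftrightarrow> distinct cs \<and> length cs \<ge> 3 \<and>
     (\<forall>i<length cs. \<forall>j<length cs. adj (cs ! i) (cs ! j) \<longleftrightarrow>
        j = Suc i mod length cs \<or> i = Suc j mod length cs)"

definition ordering_of :: "'v list \<Rightarrow> 'v set \<Rightarrow> bool" where
  "ordering_of vs S \<longleftrightarrow> distinct vs \<and> set vs = S"

definition second_ordering :: "('v::finite \<Rightarrow> 'v \<Rightarrow> bool) \<Rightarrow> 'v \<Rightarrow> 'v list \<Rightarrow> bool" where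
  "second_ordering adj x ys \<longleftrightarrow> length ys = 6 \<and> ordering_of ys (sphere_at adj 2 x) \<and>
     (\<forall>(i, j)\<in>{(0, 1), (2, 3), (4, 5)}. \<exists>z\<in>sphere_at adj 1 x. adj z (ys ! i) \<and> adj z (ys ! j)) \<and>
     induces_cycle adj [ys ! 0, ys ! 2, ys ! 4, ys ! 1, ys ! 3, ys ! 5]"


section \<open>The Terwilliger algebra\<close>

definition adj_matrix :: "('v::finite \<Rightarrow> 'v \<Rightarrow> bool) \<Rightarrow> complex^'v^'v" where
  "adj_matrix adj = (\<chi> y z. if adj y z then 1 else 0)"

definition Estar :: "('v::finite \<Rightarrow> 'v \<Rightarrow> bool) \<Rightarrow> 'v \<Rightarrow> nat \<Rightarrow> complex^'v^'v" where
  "Estar adj x i = (\<chi> y z. if y = z \<and> gdist adj x y = i then 1 else 0)"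

definition estar :: "('v::finite \<Rightarrow> 'v \<Rightarrow> bool) \<Rightarrow> 'v \<Rightarrow> nat \<Rightarrow> complex^'v" where
  "estar adj x i = (\<chi> y. if gdist adj x y = i then 1 else 0)"

definition cmscale :: "complex \<Rightarrow> complex^'n^'m \<Rightarrow> complex^'n^'m" where
  "cmscale c M = (\<chi> i j. c * M $ i $ j)"

interpretation cmat: vector_space "cmscale :: complex \<Rightarrow> complex^'n^'m \<Rightarrow> _"
  by unfold_locales (simp_all add: cmscale_def vec_eq_iff algebra_simps)

definition matrix_subalgebra :: "(complex^'v^'v) set \<Rightarrow> bool" where
  "matrix_subalgebra S \<longleftrightarrow> cmat.subspace S \<and> Finite_Cartesian_Product.mat 1 \<in> S \<and>
     (\<forall>B\<in>S. \<forall>C\<in>S. B ** C \<in> S)"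

definition terwilliger :: "('v::finite \<Rightarrow> 'v \<Rightarrow> bool) \<Rightarrow> 'v \<Rightarrow> (complex^'v^'v) set" where
  "terwilliger adj x =
     matrix_subalgebra hull ({adj_matrix adj} \<union> Estar adj x ` {0..gdiam adj})"


section \<open>Modules\<close>

definition hinner :: "complex^'v \<Rightarrow> complex^'v \<Rightarrow> complex" where
  "hinner u v = (\<Sum>y\<in>UNIV. u $ y * cnj (v $ y))"

definition is_module :: "(complex^'v^'v) set \<Rightarrow> (complex^'v) set \<Rightarrow> bool" where
  "is_module T W \<longleftrightarrow> vec.subspace W \<and> (\<forall>B\<in>T. \<forall>w\<in>W. B *v w \<in> W)"

definition irreducible_module :: "(complex^'v^'v) set \<Rightarrow> (complex^'v) set \<Rightarrow> bool" where
  "irreducible_module T W \<longleftrightarrow> is_module T W \<and> W \<noteq> {0} \<and>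
     \<not> (\<exists>U. is_module T U \<and> U \<noteq> {0} \<and> U \<subset> W)"

definition module_isomorphic ::
    "(complex^'v^'v) set \<Rightarrow> (complex^'v) set \<Rightarrow> (complex^'v) set \<Rightarrow> bool" where
  "module_isomorphic T U W \<longleftrightarrow> (\<exists>f. bij_betw f U W \<and>
     (\<forall>u\<in>U. \<forall>v\<in>U. f (u + v) = f u + f v) \<and>
     (\<forall>c. \<forall>u\<in>U. f (c *s u) = c *s f u) \<and>
     (\<forall>B\<in>T. \<forall>u\<in>U. f (B *v u) = B *v f u))"

text \<open>The third conjunct says that the whole space is the direct sum of the members of \<open>Ws\<close>.\<close>

definition orthogonal_decomposition ::
    "(complex^'v^'v) set \<Rightarrow> (complex^'v) set list \<Rightarrow> bool" where
  "orthogonal_decomposition T Ws \<longleftrightarrow>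
     (\<forall>W\<in>set Ws. irreducible_module T W) \<and>
     (\<forall>i<length Ws. \<forall>j<length Ws. i \<noteq> j \<longrightarrow>
        (\<forall>u\<in>Ws ! i. \<forall>v\<in>Ws ! j. hinner u v = 0)) \<and>
     (\<forall>v. \<exists>!us. list_all2 (\<in>) us Ws \<and> sum_list us = v)"

definition isomorphic_summands ::
    "(complex^'v^'v) set \<Rightarrow> (complex^'v) set \<Rightarrow> (complex^'v) set list \<Rightarrow> nat" where
  "isomorphic_summands T W Ws = card {i. i < length Ws \<and> module_isomorphic T (Ws ! i) W}"

text \<open>A multiplicity must not depend on the decomposition in which it is counted.\<close>

definition has_multiplicity ::
    "(complex^'v^'v) set \<Rightarrow> (complex^'v) set \<Rightarrow> nat \<Rightarrow> bool" where
  "has_multiplicity T W m \<longleftrightarrow>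
     (\<exists>Ws. orthogonal_decomposition T Ws) \<and>
     (\<forall>Ws. orthogonal_decomposition T Ws \<longrightarrow> isomorphic_summands T W Ws = m)"

definition Estar_image ::
    "('v::finite \<Rightarrow> 'v \<Rightarrow> bool) \<Rightarrow> 'v \<Rightarrow> nat \<Rightarrow> (complex^'v) set \<Rightarrow> (complex^'v) set" where
  "Estar_image adj x i W = (\<lambda>w. Estar adj x i *v w) ` W"

definition module_support ::
    "('v::finite \<Rightarrow> 'v \<Rightarrow> bool) \<Rightarrow> 'v \<Rightarrow> (complex^'v) set \<Rightarrow> nat set" where
  "module_support adj x W = {i. i \<le> gdiam adj \<and> Estar_image adj x i W \<noteq> {0}}"

definition endpoint :: "('v::finite \<Rightarrow> 'v \<Rightarrow> bool) \<Rightarrow> 'v \<Rightarrow> (complex^'v) set \<Rightarrow> nat" where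
  "endpoint adj x W = Min (module_support adj x W)"

definition module_diam :: "('v::finite \<Rightarrow> 'v \<Rightarrow> bool) \<Rightarrow> 'v \<Rightarrow> (complex^'v) set \<Rightarrow> nat" where
  "module_diam adj x W = card (module_support adj x W) - 1"

definition module_shape :: "('v::finite \<Rightarrow> 'v \<Rightarrow> bool) \<Rightarrow> 'v \<Rightarrow> (complex^'v) set \<Rightarrow> nat list" where
  "module_shape adj x W = map (\<lambda>k. vec.dim (Estar_image adj x (endpoint adj x W + k) W))
     [0..<module_diam adj x W + 1]"


section \<open>Pure bases and representing matrices\<close>

definition pure_vector :: "('v::finite \<Rightarrow> 'v \<Rightarrow> bool) \<Rightarrow> 'v \<Rightarrow> nat \<Rightarrow> complex^'v \<Rightarrow> bool" where
  "pure_vector adj x i v \<longleftrightarrow> i \<le> gdiam adj \<and> v \<noteq> 0 \<and> v \<in> Estar_image adj x i UNIV"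

definition pure_basis ::
    "('v::finite \<Rightarrow> 'v \<Rightarrow> bool) \<Rightarrow> 'v \<Rightarrow> (complex^'v) set \<Rightarrow> (complex^'v) list \<Rightarrow> bool" where
  "pure_basis adj x W vs \<longleftrightarrow>
     distinct vs \<and> vec.independent (set vs) \<and> vec.span (set vs) = W \<and>
     (\<exists>supps. sorted supps \<and> list_all2 (pure_vector adj x) supps vs)"

definition essential_part :: "'v list \<Rightarrow> complex^'v \<Rightarrow> complex list" where
  "essential_part vs v = map (\<lambda>y. v $ y) vs"

text \<open>A seed of \<open>W\<close>, given by its essential part \<open>cs\<close> in the ordering \<open>vs\<close> of the sphere
  whose radius is the endpoint of \<open>W\<close>.\<close>

definition is_seed :: "('v::finite \<Rightarrow> 'v \<Rightarrow> bool) \<Rightarrow> 'v \<Rightarrow> (complex^'v) set \<Rightarrow> 'v list \<Rightarrow>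
    complex^'v \<Rightarrow> complex list \<Rightarrow> bool" where
  "is_seed adj x W vs v cs \<longleftrightarrow>
     ordering_of vs (sphere_at adj (endpoint adj x W) x) \<and>
     pure_vector adj x (endpoint adj x W) v \<and> essential_part vs v = cs \<and>
     vec.span {v} = Estar_image adj x (endpoint adj x W) W"

definition represents ::
    "complex^'v^'v \<Rightarrow> (complex^'v) list \<Rightarrow> complex mat \<Rightarrow> bool" where
  "represents A vs B \<longleftrightarrow> B \<in> carrier_mat (length vs) (length vs) \<and>
     (\<forall>j<length vs. A *v (vs ! j) = (\<Sum>i<length vs. (B $$ (i, j)) *s (vs ! i)))"

definition module_data :: "('v::finite \<Rightarrow> 'v \<Rightarrow> bool) \<Rightarrow> 'v \<Rightarrow> (complex^'v) set \<Rightarrow>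
    nat \<Rightarrow> nat \<Rightarrow> nat \<Rightarrow> nat \<Rightarrow> nat list \<Rightarrow> bool" where
  "module_data adj x W r m l \<delta> shp \<longleftrightarrow>
     endpoint adj x W = r \<and> has_multiplicity (terwilliger adj x) W m \<and>
     vec.dim W = l \<and> module_diam adj x W = \<delta> \<and> module_shape adj x W = shp"

definition basis_data :: "('v::finite \<Rightarrow> 'v \<Rightarrow> bool) \<Rightarrow> 'v \<Rightarrow> (complex^'v) set \<Rightarrow>
    (complex^'v) list \<Rightarrow> complex list list \<Rightarrow> complex set \<Rightarrow> bool" where
  "basis_data adj x W vs rs evs \<longleftrightarrow>
     pure_basis adj x W vs \<and>
     represents (adj_matrix adj) vs (mat_of_rows_list (length vs) rs) \<and>
     {\<theta>. eigenvalue (mat_of_rows_list (length vs) rs) \<theta>} = evs"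

definition eigenspace :: "complex^'v^'v \<Rightarrow> complex \<Rightarrow> (complex^'v) set" where
  "eigenspace A \<theta> = {v. A *v v = \<theta> *s v}"

end

theory Submission
  imports Defs
begin

text \<open>Each of the modules has a basis \<open>v\<^sub>0, v\<^sub>1, \<dots>\<close> of pure vectors with consecutive supports
  on which \<open>A\<close> acts by a tridiagonal matrix with nonzero off-diagonal entries. Such a span is irreducible,
  since projecting \<open>A v\<^sub>k\<close> to the neighbouring subconstituents reaches every other basis vector, and its
  isomorphism class is determined by the endpoint and the matrix. A labelling of the ten vertices by
  \<open>x\<close>, its neighbours and the hexagon at distance two makes all coordinates explicit, and ten
  pairwise orthogonal vectors exhaust the standard module. The dimension of \<open>T\<close> is the number of
  orbits of the stabilizer of \<open>x\<close> on pairs of vertices.\<close>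

section \<open>Modules of the Terwilliger algebra\<close>

text \<open>A multiplicity quantifies over all orthogonal decompositions, so counting in one of them
  is not enough. The count is therefore identified with the dimension of a subspace of
  \<open>E_r^* V\<close> that mentions no decomposition: the kernel of \<open>Q\<close>, where
  \<open>Q\<close> is \<open>0\<close> for type I, \<open>E_0^* A\<close> for type II and
  \<open>A - \<theta>\<close> for types III and IV. One explicit decomposition then fixes the
  number. The ordering of the first sphere is arbitrary, while that of the second is constrained by
  the hexagon. Hence type II is described as the vectors on the first sphere with coordinate sum
  zero, and types III and IV by coordinates on the hexagon. The value 15 is not derived from the
  decomposition. The matrices constant on orbits absorb left multiplication by the generators and
  contain the identity, which bounds \<open>T\<close> from above; every orbit indicator is an
  expression in \<open>A\<close> and the \<open>E_i^*\<close>, which bounds it from below.\<close>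

lemma matrix_subalgebra_terwilliger: "matrix_subalgebra (terwilliger adj x)"
  unfolding terwilliger_def
  by (rule hull_in) (auto simp: matrix_subalgebra_def cmat.subspace_def)

lemma adj_matrix_in_terwilliger: "adj_matrix adj \<in> terwilliger adj x"
  unfolding terwilliger_def by (rule hull_inc) simp

lemma Estar_in_terwilliger: "i \<le> gdiam adj \<Longrightarrow> Estar adj x i \<in> terwilliger adj x"
  unfolding terwilliger_def by (rule hull_inc) simp

lemma terwilliger_minimal:
  assumes "matrix_subalgebra S" "adj_matrix adj \<in> S" "\<And>i. i \<le> gdiam adj \<Longrightarrow> Estar adj x i \<in> S"
  shows "terwilliger adj x \<subseteq> S"
  unfolding terwilliger_def by (rule hull_minimal) (use assms in auto)

lemma terwilliger_closed:
  shows terwilliger_one: "Finite_Cartesian_Product.mat 1 \<in> terwilliger adj x"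
    and terwilliger_mult: "B \<in> terwilliger adj x \<Longrightarrow> C \<in> terwilliger adj x \<Longrightarrow> B ** C \<in> terwilliger adj x"
    and terwilliger_diff: "B \<in> terwilliger adj x \<Longrightarrow> C \<in> terwilliger adj x \<Longrightarrow> B - C \<in> terwilliger adj x"
    and terwilliger_scale: "B \<in> terwilliger adj x \<Longrightarrow> cmscale c B \<in> terwilliger adj x"
    and terwilliger_zero: "0 \<in> terwilliger adj x"
  using matrix_subalgebra_terwilliger[of adj x] unfolding matrix_subalgebra_def
  by (auto intro: cmat.subspace_add cmat.subspace_diff cmat.subspace_scale cmat.subspace_0)

lemma cmscale_vector_mult: "cmscale c B *v v = c *s (B *v v)"
  by (simp add: cmscale_def matrix_vector_mult_def vec_eq_iff sum_distrib_left mult.assoc)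

lemma cmscale_mult_left: "cmscale c B ** C = cmscale c (B ** C)"
  by (simp add: cmscale_def matrix_matrix_mult_def vec_eq_iff sum_distrib_left mult.assoc)

text \<open>The matrices that map \<open>W\<close> into itself form a subalgebra, so the generators
  decide.\<close>

lemma is_module_terwilligerI:
  assumes W: "vec.subspace W"
    and A: "\<And>w. w \<in> W \<Longrightarrow> adj_matrix adj *v w \<in> W"
    and E: "\<And>i w. i \<le> gdiam adj \<Longrightarrow> w \<in> W \<Longrightarrow> Estar adj x i *v w \<in> W"
  shows "is_module (terwilliger adj x) W"
proof -
  have "matrix_subalgebra {B. \<forall>w\<in>W. B *v w \<in> W}"
    using W unfolding matrix_subalgebra_def
    by (auto simp: cmat.subspace_def vec.subspace_def cmscale_vector_mult
        matrix_vector_mult_add_rdistrib simp flip: matrix_vector_mul_assoc)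
  then have "terwilliger adj x \<subseteq> {B. \<forall>w\<in>W. B *v w \<in> W}"
    by (rule terwilliger_minimal) (use A E in auto)
  then show ?thesis using W by (auto simp: is_module_def)
qed

text \<open>Again a subalgebra containing the generators, but its condition joins invariance of
  \<open>W\<close> to commutation with \<open>f\<close>: in \<open>f (B *v (C *v w))\<close> the
  vector \<open>C *v w\<close> must stay in \<open>W\<close> before \<open>B\<close> can be moved
  past \<open>f\<close>.\<close>

lemma equivariant_terwilligerI:
  assumes f: "Vector_Spaces.linear (*s) (*s) f" and W: "is_module (terwilliger adj x) W"
    and A: "\<And>w. w \<in> W \<Longrightarrow> f (adj_matrix adj *v w) = adj_matrix adj *v f w"
    and E: "\<And>i w. i \<le> gdiam adj \<Longrightarrow> w \<in> W \<Longrightarrow> f (Estar adj x i *v w) = Estar adj x i *v f w"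
    and B: "B \<in> terwilliger adj x" and w: "w \<in> W"
  shows "f (B *v w) = B *v f w"
proof -
  interpret f: Vector_Spaces.linear "(*s)" "(*s)" f by (fact f)
  have W': "vec.subspace W" using W by (simp add: is_module_def)
  let ?S = "{B. \<forall>w\<in>W. B *v w \<in> W \<and> f (B *v w) = B *v f w}"
  have "matrix_subalgebra ?S"
    using W' unfolding matrix_subalgebra_def
    by (auto simp: cmat.subspace_def vec.subspace_def cmscale_vector_mult f.add f.scale f.zero
        matrix_vector_mult_add_rdistrib simp flip: matrix_vector_mul_assoc)
  then have "terwilliger adj x \<subseteq> ?S"
    by (rule terwilliger_minimal)
      (use A E W in \<open>auto simp: is_module_def adj_matrix_in_terwilliger Estar_in_terwilliger\<close>)
  then show ?thesis using B w by auto
qed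

lemma module_isomorphic_refl: "module_isomorphic T W W"
  unfolding module_isomorphic_def by (rule exI[of _ "\<lambda>x. x"]) (auto simp: bij_betw_def)

text \<open>Closure of \<open>U\<close> under sums, scalars and \<open>T\<close> is what allows
  \<open>inv_into U f\<close> to be evaluated at the images.\<close>

lemma module_isomorphic_sym:
  assumes "module_isomorphic T U W" and U: "is_module T U"
  shows "module_isomorphic T W U"
proof -
  obtain f where f: "bij_betw f U W" "\<And>u v. u \<in> U \<Longrightarrow> v \<in> U \<Longrightarrow> f (u + v) = f u + f v"
    "\<And>c u. u \<in> U \<Longrightarrow> f (c *s u) = c *s f u" "\<And>B u. B \<in> T \<Longrightarrow> u \<in> U \<Longrightarrow> f (B *v u) = B *v f u"
    using assms unfolding module_isomorphic_def by blast
  let ?g = "inv_into U f"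
  have g: "\<exists>u\<in>U. w = f u" if "w \<in> W" for w using f(1) that by (auto simp: bij_betw_def)
  have gf: "?g (f u) = u" if "u \<in> U" for u using f(1) that by (simp add: bij_betw_inv_into_left)
  have s: "vec.subspace U" "\<And>B u. B \<in> T \<Longrightarrow> u \<in> U \<Longrightarrow> B *v u \<in> U" using U by (auto simp: is_module_def)
  have "?g (u + v) = ?g u + ?g v" if "u \<in> W" "v \<in> W" for u v
    using g[OF that(1)] g[OF that(2)] by (metis gf f(2) vec.subspace_add[OF s(1)])
  moreover have "?g (c *s u) = c *s ?g u" if "u \<in> W" for c u
    using g[OF that] by (metis gf f(3) vec.subspace_scale[OF s(1)])
  moreover have "?g (B *v u) = B *v ?g u" if "B \<in> T" "u \<in> W" for B u
    using g[OF that(2)] that(1) by (metis gf f(4) s(2))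
  ultimately show ?thesis
    unfolding module_isomorphic_def using bij_betw_inv_into[OF f(1)] by blast
qed

text \<open>Annihilators are isomorphism invariants. All non-isomorphisms come from this, with
  \<open>B\<close> a projection \<open>Estar\<close> when the endpoints differ and
  \<open>A - \<theta>\<close> when they agree.\<close>

lemma module_isomorphic_kernel:
  assumes "module_isomorphic T U W" "B \<in> T" "\<And>u. u \<in> U \<Longrightarrow> B *v u = 0" "w \<in> W"
  shows "B *v w = 0"
proof -
  obtain f where f: "bij_betw f U W" "\<And>c u. u \<in> U \<Longrightarrow> f (c *s u) = c *s f u"
    "\<And>B u. B \<in> T \<Longrightarrow> u \<in> U \<Longrightarrow> f (B *v u) = B *v f u"
    using assms unfolding module_isomorphic_def by blast
  obtain u where u: "u \<in> U" "w = f u" using f(1) assms(4) by (auto simp: bij_betw_def)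
  have "B *v w = f (0 *s u)" using assms(2,3) u f(3)[of B u] by simp
  also have "\<dots> = 0" using f(2)[OF u(1), of 0] by simp
  finally show ?thesis .
qed

section \<open>Orthogonality\<close>

lemma hinner_linear:
  shows hinner_add_left: "hinner (u + v) w = hinner u w + hinner v w"
    and hinner_add_right: "hinner w (u + v) = hinner w u + hinner w v"
    and hinner_scale_left: "hinner (c *s u) w = c * hinner u w"
    and hinner_scale_right: "hinner w (c *s u) = cnj c * hinner w u"
    and hinner_0_left[simp]: "hinner 0 w = 0"
    and hinner_0_right[simp]: "hinner w 0 = 0"
  by (simp_all add: hinner_def algebra_simps sum.distrib sum_distrib_left)

lemma hinner_sum_left: "hinner (sum f I) w = (\<Sum>i\<in>I. hinner (f i) w)"
  by (induction I rule: infinite_finite_induct) (auto simp: hinner_add_left)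

lemma hinner_commute: "hinner v u = cnj (hinner u v)"
  by (simp add: hinner_def cnj_sum mult.commute)

lemma hinner_eq_0_commute: "hinner v u = 0 \<longleftrightarrow> hinner u v = 0"
  by (subst hinner_commute) simp

lemma hinner_self_eq_0_iff: "hinner v v = 0 \<longleftrightarrow> v = 0"
proof
  assume "hinner v v = 0"
  moreover have "hinner v v = of_real (\<Sum>y\<in>UNIV. (cmod (v $ y))\<^sup>2)"
    by (simp add: hinner_def complex_norm_square del: of_real_power)
  ultimately have "(\<Sum>y\<in>UNIV. (cmod (v $ y))\<^sup>2) = 0" by (simp only: of_real_eq_0_iff)
  then show "v = 0" by (simp add: sum_nonneg_eq_0_iff vec_eq_iff)
qed simp

lemma hinner_span_eq_0:
  assumes "\<And>a b. a \<in> S \<Longrightarrow> b \<in> S' \<Longrightarrow> hinner a b = 0" and "u \<in> vec.span S" "v \<in> vec.span S'"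
  shows "hinner u v = 0"
proof -
  have "hinner a v = 0" if "a \<in> S" for a
    using assms(3) by (induction rule: vec.span_induct_alt)
      (auto simp: hinner_linear assms(1)[OF that])
  note * = this
  show ?thesis
    using assms(2) by (induction rule: vec.span_induct_alt) (auto simp: hinner_linear *)
qed

lemma orthogonal_independent:
  assumes "\<And>a b. a \<in> S \<Longrightarrow> b \<in> S \<Longrightarrow> a \<noteq> b \<Longrightarrow> hinner a b = 0" and "0 \<notin> S"
  shows "vec.independent S"
proof
  assume "vec.dependent S"
  then obtain t u a where t: "finite t" "t \<subseteq> S" "(\<Sum>v\<in>t. u v *s v) = 0" "a \<in> t" "u a \<noteq> 0"
    unfolding vec.dependent_explicit by blast
  have "0 = hinner (\<Sum>v\<in>t. u v *s v) a" using t by simp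
  also have "\<dots> = (\<Sum>v\<in>t. if v = a then u a * hinner a a else 0)"
    unfolding hinner_sum_left using t assms(1)
    by (intro sum.cong) (auto simp: hinner_linear subset_iff)
  also have "\<dots> = u a * hinner a a" using t by simp
  finally show False using t assms(2) by (auto simp: hinner_self_eq_0_iff)
qed

text \<open>\<open>sorted_wrt\<close> asks only for pairs in list order; conjugate symmetry gives
  the other half. Two equal entries would have norm zero, whence distinctness.\<close>

lemma orthogonal_list:
  assumes "sorted_wrt (\<lambda>u v. hinner u v = 0) vs" "0 \<notin> set vs"
  shows orthogonal_list_distinct: "distinct vs"
    and orthogonal_list_independent: "vec.independent (set vs)"
proof -
  have *: "hinner (vs ! i) (vs ! j) = 0" if "i < length vs" "j < length vs" "i \<noteq> j" for i j
    using assms(1) that unfolding sorted_wrt_iff_nth_less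
    by (metis hinner_eq_0_commute linorder_neqE_nat)
  show "distinct vs"
    unfolding distinct_conv_nth using * assms(2) by (metis hinner_self_eq_0_iff nth_mem)
  show "vec.independent (set vs)"
    by (rule orthogonal_independent) (use * assms(2) in \<open>auto simp: in_set_conv_nth\<close>)
qed

lemma orthogonal_list_span_UNIV:
  fixes vs :: "(complex^'v::finite) list"
  assumes "sorted_wrt (\<lambda>u v. hinner u v = 0) vs" "0 \<notin> set vs" "length vs = CARD('v)"
  shows "vec.span (set vs) = UNIV"
proof -
  have "card (set vs) = vec.dim (UNIV :: (complex^'v) set)"
    using distinct_card[OF orthogonal_list_distinct[OF assms(1,2)]] assms(3)
    by (simp add: vec.dim_UNIV vec.dimension_def card_cart_basis)
  then show ?thesis
    using vec.card_eq_dim[of "set vs" UNIV] orthogonal_list_independent[OF assms(1,2)] by auto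
qed

text \<open>Pairing the sum with its \<open>i\<close>-th term leaves the squared norm of that term.
  It serves twice: for uniqueness of components, and for showing that an element of \<open>T\<close>
  that kills a vector kills its components.\<close>

lemma orthogonal_sum_list_eq_0:
  assumes "list_all2 (\<in>) us Ws" "sum_list us = 0"
    and "\<And>i j u v. i < length Ws \<Longrightarrow> j < length Ws \<Longrightarrow> i \<noteq> j \<Longrightarrow> u \<in> Ws ! i \<Longrightarrow> v \<in> Ws ! j \<Longrightarrow> hinner u v = 0"
    and "i < length Ws"
  shows "us ! i = 0"
proof -
  have l: "length us = length Ws" and m: "\<And>j. j < length Ws \<Longrightarrow> us ! j \<in> Ws ! j"
    using assms(1) by (auto simp: list_all2_conv_all_nth)
  have "0 = hinner (\<Sum>j<length us. us ! j) (us ! i)"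
    using assms(2) by (simp add: sum_list_sum_nth atLeast0LessThan)
  also have "\<dots> = (\<Sum>j<length us. if j = i then hinner (us ! i) (us ! i) else 0)"
    unfolding hinner_sum_left using assms(3,4) l m by (intro sum.cong) auto
  also have "\<dots> = hinner (us ! i) (us ! i)" using assms(4) l by simp
  finally show ?thesis by (simp add: hinner_self_eq_0_iff)
qed

lemma span_concat:
  "v \<in> vec.span (set (concat bs)) \<Longrightarrow>
     \<exists>us. list_all2 (\<in>) us (map (\<lambda>vs. vec.span (set vs)) bs) \<and> sum_list us = v"
proof (induction bs arbitrary: v)
  case (Cons b bs)
  then obtain p q where pq: "v = p + q" "p \<in> vec.span (set b)" "q \<in> vec.span (set (concat bs))"
    by (auto simp: vec.span_Un simp del: set_concat)
  from Cons.IH[OF pq(3)] obtain us where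
    us: "list_all2 (\<in>) us (map (\<lambda>vs. vec.span (set vs)) bs)" "sum_list us = q" by blast
  show ?case by (rule exI[of _ "p # us"]) (use us pq in simp)
qed auto

lemma orthogonal_concat_nth:
  assumes "sorted_wrt R (concat bs)" "i < j" "j < length bs" "a \<in> set (bs ! i)" "b \<in> set (bs ! j)"
  shows "R a b"
  using assms
proof (induction bs arbitrary: i j)
  case (Cons c bs)
  then obtain j' where j: "j = Suc j'" by (cases j) auto
  show ?case
  proof (cases i)
    case 0
    then show ?thesis using Cons.prems j by (force simp: sorted_wrt_append)
  next
    case (Suc i')
    then show ?thesis using Cons j by (auto simp: sorted_wrt_append)
  qed
qed simp

text \<open>Existence of components is a dimension count: orthogonal nonzero vectors, as many as
  there are vertices, span the space.\<close>

lemma orthogonal_decompositionI: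
  fixes bs :: "(complex^'v::finite) list list"
  assumes irr: "\<And>vs. vs \<in> set bs \<Longrightarrow> irreducible_module T (vec.span (set vs))"
    and orth: "sorted_wrt (\<lambda>u v. hinner u v = 0) (concat bs)"
    and "0 \<notin> set (concat bs)" "length (concat bs) = CARD('v)"
  shows "orthogonal_decomposition T (map (\<lambda>vs. vec.span (set vs)) bs)"
proof -
  let ?Ws = "map (\<lambda>vs. vec.span (set vs)) bs"
  have o: "hinner u v = 0" if ij: "i < length bs" "j < length bs" "i \<noteq> j"
    "u \<in> vec.span (set (bs ! i))" "v \<in> vec.span (set (bs ! j))" for i j u v
  proof (rule hinner_span_eq_0[OF _ ij(4,5)])
    fix a b assume "a \<in> set (bs ! i)" "b \<in> set (bs ! j)"
    then show "hinner a b = 0"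
      using orthogonal_concat_nth[OF orth] ij(1-3) by (metis hinner_eq_0_commute linorder_neqE_nat)
  qed
  have "\<exists>!us. list_all2 (\<in>) us ?Ws \<and> sum_list us = v" for v
  proof (rule ex_ex1I)
    show "\<exists>us. list_all2 (\<in>) us ?Ws \<and> sum_list us = v"
      by (rule span_concat) (use orthogonal_list_span_UNIV[OF assms(2-4)] in auto)
  next
    fix us us' assume us: "list_all2 (\<in>) us ?Ws \<and> sum_list us = v" "list_all2 (\<in>) us' ?Ws \<and> sum_list us' = v"
    then have l: "length us = length bs" "length us' = length bs" by (auto dest: list_all2_lengthD)
    \<comment> \<open>The difference of two expansions of \<open>v\<close> is an expansion of
      zero.\<close>
    let ?d = "map2 (-) us us'"
    have "list_all2 (\<in>) ?d ?Ws"
      using us l by (auto simp: list_all2_conv_all_nth vec.span_diff)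
    moreover have "sum_list ?d = 0"
      using us l by (simp add: sum_list_sum_nth sum_subtractf)
    ultimately have "?d ! i = 0" if "i < length bs" for i
      by (rule orthogonal_sum_list_eq_0) (use that o in auto)
    then show "us = us'" using l by (auto intro: nth_equalityI)
  qed
  then show ?thesis
    unfolding orthogonal_decomposition_def using o irr by auto
qed

section \<open>Thin modules\<close>

lemma gdist_le_gdiam: "gdist adj y z \<le> gdiam adj"
proof -
  have "{gdist adj y z |y z. True} = (\<lambda>(y, z). gdist adj y z) ` UNIV" by auto
  then have "finite {gdist adj y z |y z. True}" by simp
  then show ?thesis unfolding gdiam_def by (rule Max_ge) blast
qed

lemma Estar_vector_mult: "Estar adj x i *v v = (\<chi> y. if gdist adj x y = i then v $ y else 0)"
proof -
  have "(\<Sum>j\<in>UNIV. Estar adj x i $ y $ j * v $ j) =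
      (\<Sum>j\<in>UNIV. if j = y then (if gdist adj x y = i then v $ y else 0) else 0)" for y
    by (intro sum.cong) (auto simp: Estar_def)
  then show ?thesis by (simp add: vec_eq_iff matrix_vector_mult_def)
qed

lemma Estar_Estar: "Estar adj x i *v (Estar adj x j *v v) = (if i = j then Estar adj x i *v v else 0)"
  by (auto simp: Estar_vector_mult vec_eq_iff)

lemma sum_Estar: "(\<Sum>i\<le>gdiam adj. Estar adj x i *v v) = v"
  by (simp add: vec_eq_iff Estar_vector_mult gdist_le_gdiam)

lemma pure_vector_iff: "pure_vector adj x i v \<longleftrightarrow> i \<le> gdiam adj \<and> v \<noteq> 0 \<and> Estar adj x i *v v = v"
  unfolding pure_vector_def Estar_image_def by (auto simp: Estar_Estar image_iff) metis

lemma hinner_Estar: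
  assumes "Estar adj x i *v u = u" "Estar adj x j *v v = v" "i \<noteq> j"
  shows "hinner u v = 0"
proof -
  have "hinner (Estar adj x i *v u) (Estar adj x j *v v) = 0"
    unfolding hinner_def by (rule sum.neutral) (use assms(3) in \<open>auto simp: Estar_vector_mult\<close>)
  then show ?thesis by (simp add: assms)
qed

lemma Estar_image_span: "Estar_image adj x i (vec.span S) = vec.span ((*v) (Estar adj x i) ` S)"
  unfolding Estar_image_def by (rule vec.span_image[symmetric])

text \<open>The name follows Terwilliger's notion of a thin module: every nonzero
  \<open>E_i^* W\<close> is a line. Consecutive radii tie the \<open>k\<close>-th basis vector to
  the sphere of radius \<open>r + k\<close>, so that projections pick out single basis
  vectors.\<close>

definition thin_basis ::
    "('v::finite \<Rightarrow> 'v \<Rightarrow> bool) \<Rightarrow> 'v \<Rightarrow> nat \<Rightarrow> complex mat \<Rightarrow> (complex^'v) list \<Rightarrow> bool" where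
  "thin_basis adj x r B vs \<longleftrightarrow> vs \<noteq> [] \<and> represents (adj_matrix adj) vs B \<and>
     (\<forall>k<length vs. pure_vector adj x (r + k) (vs ! k)) \<and>
     (\<forall>k. Suc k < length vs \<longrightarrow> B $$ (k, Suc k) \<noteq> 0 \<and> B $$ (Suc k, k) \<noteq> 0)"

lemma thin_basis_Estar:
  assumes "thin_basis adj x r B vs" "k < length vs"
  shows "Estar adj x i *v (vs ! k) = (if i = r + k then vs ! k else 0)"
proof -
  have "Estar adj x (r + k) *v (vs ! k) = vs ! k"
    using assms by (auto simp: thin_basis_def pure_vector_iff)
  then show ?thesis using Estar_Estar[of adj x i "r + k" "vs ! k"] by auto
qed

lemma thin_basis_orthogonal:
  assumes "thin_basis adj x r B vs"
  shows "sorted_wrt (\<lambda>u v. hinner u v = 0) vs" and "0 \<notin> set vs"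
  using assms hinner_Estar[of adj x "r + _" _ "r + _"] thin_basis_Estar[OF assms]
  unfolding sorted_wrt_iff_nth_less
  by (auto simp: thin_basis_def pure_vector_iff in_set_conv_nth)

text \<open>Every other term of \<open>A v_k\<close> is supported on a different sphere. An element
  of \<open>T\<close> thus carries \<open>v_k\<close> to a multiple of \<open>v_j\<close>, with the
  matrix entry as factor.\<close>

lemma thin_basis_Estar_adj:
  assumes vs: "thin_basis adj x r B vs" and "j < length vs" "k < length vs"
  shows "Estar adj x (r + j) *v (adj_matrix adj *v (vs ! k)) = B $$ (j, k) *s (vs ! j)"
proof -
  have "Estar adj x (r + j) *v (adj_matrix adj *v (vs ! k)) =
      (\<Sum>i<length vs. B $$ (i, k) *s (Estar adj x (r + j) *v (vs ! i)))"
    using assms by (simp add: thin_basis_def represents_def vec.sum vec.scale)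
  also have "\<dots> = (\<Sum>i<length vs. if i = j then B $$ (j, k) *s (vs ! j) else 0)"
    by (intro sum.cong) (auto simp: thin_basis_Estar[OF vs])
  finally show ?thesis using assms(2) by simp
qed

lemma thin_module:
  assumes vs: "thin_basis adj x r B vs"
  shows "is_module (terwilliger adj x) (vec.span (set vs))"
proof (rule is_module_terwilligerI)
  let ?W = "vec.span (set vs)"
  have mem: "M *v w \<in> ?W" if "\<And>k. k < length vs \<Longrightarrow> M *v (vs ! k) \<in> ?W" "w \<in> ?W" for M w
  proof -
    have "(*v) M ` ?W = vec.span ((*v) M ` set vs)" by (rule vec.span_image[symmetric])
    also have "\<dots> \<subseteq> ?W"
      using that(1) by (intro vec.span_minimal vec.subspace_span) (auto simp: in_set_conv_nth)
    finally show ?thesis using that(2) by blast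
  qed
  show "adj_matrix adj *v w \<in> ?W" if "w \<in> ?W" for w
  proof (rule mem[OF _ that])
    fix k assume "k < length vs"
    then have "adj_matrix adj *v (vs ! k) = (\<Sum>i<length vs. B $$ (i, k) *s (vs ! i))"
      using vs by (auto simp: thin_basis_def represents_def)
    also have "\<dots> \<in> ?W" by (intro vec.span_sum vec.span_scale vec.span_base) simp
    finally show "adj_matrix adj *v (vs ! k) \<in> ?W" .
  qed
  show "Estar adj x i *v w \<in> ?W" if "w \<in> ?W" for i w
    by (rule mem[OF _ that]) (auto simp: thin_basis_Estar[OF vs] intro: vec.span_base vec.span_zero)
qed simp

text \<open>A nonzero entry of \<open>B\<close> can be inverted, so membership in \<open>U\<close>
  passes between neighbouring indices. Descending from \<open>k\<close> to \<open>0\<close> along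
  the superdiagonal and climbing along the subdiagonal reaches the whole basis.\<close>

lemma thin_basis_subset:
  assumes vs: "thin_basis adj x r B vs" and U: "is_module (terwilliger adj x) U"
    and k: "k < length vs" "vs ! k \<in> U"
  shows "vec.span (set vs) \<subseteq> U"
proof -
  have sub: "vec.subspace U" using U by (simp add: is_module_def)
  have step: "vs ! j \<in> U" if "j < length vs" "l < length vs" "B $$ (j, l) \<noteq> 0" "vs ! l \<in> U" for j l
  proof -
    have "r + j \<le> gdiam adj" using vs that(1) by (auto simp: thin_basis_def pure_vector_iff)
    then have "Estar adj x (r + j) *v (adj_matrix adj *v (vs ! l)) \<in> U"
      using U that(4) by (simp add: is_module_def adj_matrix_in_terwilliger Estar_in_terwilliger)
    then have "inverse (B $$ (j, l)) *s (B $$ (j, l) *s (vs ! j)) \<in> U"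
      using thin_basis_Estar_adj[OF vs that(1,2)] vec.subspace_scale[OF sub] by metis
    then show ?thesis using that(3) by simp
  qed
  have B: "B $$ (j, Suc j) \<noteq> 0" "B $$ (Suc j, j) \<noteq> 0" if "Suc j < length vs" for j
    using vs that by (auto simp: thin_basis_def)
  have "vs ! 0 \<in> U" using k
  proof (induction k)
    case (Suc k)
    then show ?case using step[of k "Suc k"] B by auto
  qed
  then have "vs ! j \<in> U" if "j < length vs" for j using that
  proof (induction j)
    case (Suc j)
    then show ?case using step[of "Suc j" j] B by auto
  qed
  then show ?thesis by (intro vec.span_minimal sub) (auto simp: in_set_conv_nth)
qed

lemma thin_Estar_image:
  assumes vs: "thin_basis adj x r B vs"
  shows "Estar_image adj x i (vec.span (set vs)) =
    (if r \<le> i \<and> i < r + length vs then vec.span {vs ! (i - r)} else {0})"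
proof -
  let ?S = "(*v) (Estar adj x i) ` set vs"
  show ?thesis
  proof (cases "r \<le> i \<and> i < r + length vs")
    case True
    have "v \<in> vec.span {vs ! (i - r)}" if "v \<in> ?S" for v
      using that by (auto simp: in_set_conv_nth thin_basis_Estar[OF vs] vec.span_zero vec.span_base)
    then have "vec.span ?S \<subseteq> vec.span {vs ! (i - r)}"
      by (intro vec.span_minimal vec.subspace_span) blast
    moreover have idx: "i - r < length vs" using True by linarith
    then have "Estar adj x i *v (vs ! (i - r)) \<in> vec.span ?S"
      by (intro vec.span_base imageI nth_mem)
    then have "vec.span {vs ! (i - r)} \<subseteq> vec.span ?S"
      using True thin_basis_Estar[OF vs idx, of i] by (intro vec.span_minimal vec.subspace_span) simp
    ultimately show ?thesis using True by (simp add: Estar_image_span)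
  next
    case False
    then have "?S \<subseteq> {0}" by (auto simp: in_set_conv_nth thin_basis_Estar[OF vs])
    then have "vec.span ?S = {0}" by (metis subset_singletonD vec.span_empty vec.span_insert_0)
    then show ?thesis unfolding Estar_image_span if_not_P[OF False] .
  qed
qed

lemma thin_irreducible:
  assumes vs: "thin_basis adj x r B vs"
  shows "irreducible_module (terwilliger adj x) (vec.span (set vs))"
  unfolding irreducible_module_def
proof (intro conjI notI)
  show "is_module (terwilliger adj x) (vec.span (set vs))" using vs by (rule thin_module)
  have "vs ! 0 \<noteq> 0" "vs ! 0 \<in> vec.span (set vs)"
    using vs by (auto simp: thin_basis_def pure_vector_iff intro: vec.span_base)
  then show "False" if "vec.span (set vs) = {0}" using that by auto
  assume "\<exists>U. is_module (terwilliger adj x) U \<and> U \<noteq> {0} \<and> U \<subset> vec.span (set vs)"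
  then obtain U where U: "is_module (terwilliger adj x) U" "U \<noteq> {0}" "U \<subset> vec.span (set vs)" by blast
  have sub: "vec.subspace U" using U by (simp add: is_module_def)
  then obtain u where u: "u \<in> U" "u \<noteq> 0" using U(2) vec.subspace_0 by blast
  \<comment> \<open>The projections sum to the identity, so one of them keeps \<open>u\<close>
    nonzero; the projected vector lies on a single basis line.\<close>
  then obtain i where i: "i \<le> gdiam adj" "Estar adj x i *v u \<noteq> 0"
    using sum_Estar[of adj x u] by (metis (no_types, lifting) atMost_iff sum.neutral)
  have "Estar adj x i *v u \<in> Estar_image adj x i (vec.span (set vs))"
    using u U(3) by (auto simp: Estar_image_def)
  then have r: "r \<le> i" "i < r + length vs" "Estar adj x i *v u \<in> vec.span {vs ! (i - r)}"
    using i(2) by (auto simp: thin_Estar_image[OF vs] split: if_splits)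
  then obtain c where c: "Estar adj x i *v u = c *s (vs ! (i - r))" by (auto simp: vec.span_singleton)
  have "Estar adj x i *v u \<in> U" using U(1) u(1) Estar_in_terwilliger[OF i(1)] by (auto simp: is_module_def)
  then have "inverse c *s (c *s (vs ! (i - r))) \<in> U" unfolding c by (rule vec.subspace_scale[OF sub])
  then have "vs ! (i - r) \<in> U" using i(2) c by auto
  then have "vec.span (set vs) \<subseteq> U"
    using thin_basis_subset[OF vs U(1), of "i - r"] r by auto
  then show False using U(3) by auto
qed

lemma
  assumes vs: "thin_basis adj x r B vs"
  shows thin_support: "module_support adj x (vec.span (set vs)) = {r..<r + length vs}"
    and thin_endpoint: "endpoint adj x (vec.span (set vs)) = r"
    and thin_diam: "module_diam adj x (vec.span (set vs)) = length vs - 1"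
    and thin_dim: "vec.dim (vec.span (set vs)) = length vs"
    and thin_shape: "module_shape adj x (vec.span (set vs)) = replicate (length vs) 1"
    and thin_pure_basis: "pure_basis adj x (vec.span (set vs)) vs"
proof -
  have ne: "vs \<noteq> []" and pure: "\<And>k. k < length vs \<Longrightarrow> pure_vector adj x (r + k) (vs ! k)"
    using vs by (auto simp: thin_basis_def)
  have nz: "vs ! k \<noteq> 0" if "k < length vs" for k using pure[OF that] by (simp add: pure_vector_iff)
  have le: "r + k \<le> gdiam adj" if "k < length vs" for k using pure[OF that] by (simp add: pure_vector_iff)
  have nz': "vec.span {vs ! k} \<noteq> {0}" if "k < length vs" for k
    using nz[OF that] vec.span_base[of "vs ! k" "{vs ! k}"] by auto
  show supp: "module_support adj x (vec.span (set vs)) = {r..<r + length vs}"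
    unfolding module_support_def thin_Estar_image[OF vs]
    using nz' le by (auto split: if_splits) (metis le_add_diff_inverse less_diff_conv2 add.commute)
  show e: "endpoint adj x (vec.span (set vs)) = r"
    unfolding endpoint_def supp using ne by (intro Min_eqI) auto
  show d: "module_diam adj x (vec.span (set vs)) = length vs - 1"
    unfolding module_diam_def supp by simp
  have dist: "distinct vs" and ind: "vec.independent (set vs)"
    using orthogonal_list_distinct orthogonal_list_independent thin_basis_orthogonal[OF vs] by auto
  show "vec.dim (vec.span (set vs)) = length vs"
    using vec.dim_span_eq_card_independent[OF ind] distinct_card[OF dist] by simp
  show "module_shape adj x (vec.span (set vs)) = replicate (length vs) 1"
  proof (rule nth_equalityI)
    fix k assume "k < length (module_shape adj x (vec.span (set vs)))"
    then have k: "k < length vs" using ne by (simp add: module_shape_def d)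
    then have "vec.dim (vec.span {vs ! k}) = 1"
      using nz[OF k] by (subst vec.dim_span_eq_card_independent) auto
    then show "module_shape adj x (vec.span (set vs)) ! k = replicate (length vs) 1 ! k"
      using k ne by (simp add: module_shape_def d e thin_Estar_image[OF vs] del: vec.dim_span)
  qed (use ne in \<open>simp add: module_shape_def d\<close>)
  show "pure_basis adj x (vec.span (set vs)) vs"
    unfolding pure_basis_def using dist ind pure
    by (auto simp: list_all2_conv_all_nth intro!: exI[of _ "[r..<r + length vs]"])
qed

lemma thin_isomorphic:
  assumes vs: "thin_basis adj x r B vs" and ws: "thin_basis adj x r B ws"
  shows "module_isomorphic (terwilliger adj x) (vec.span (set vs)) (vec.span (set ws))"
proof -
  have len: "length ws = length vs" using vs ws by (auto simp: thin_basis_def represents_def)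
  \<comment> \<open>Basis values extend to a linear map of the whole space; doing this in both
    directions yields the inverse on the spans.\<close>
  have *: "\<exists>f. Vector_Spaces.linear (*s) (*s) f \<and> (\<forall>k<length vs. f (vs ! k) = ws ! k)"
    if vs: "thin_basis adj x r B vs" and "length ws = length vs" for vs ws :: "(complex^'a) list"
  proof -
    have dist: "distinct vs" and ind: "vec.independent (set vs)"
      using orthogonal_list_distinct orthogonal_list_independent thin_basis_orthogonal[OF vs] by auto
    obtain f where f: "Vector_Spaces.linear (*s) (*s) f" "\<forall>v\<in>set vs. f v = the (map_of (zip vs ws) v)"
      using vec.linear_independent_extend[OF ind, of "\<lambda>v. the (map_of (zip vs ws) v)"] by blast
    then have "f (vs ! k) = ws ! k" if "k < length vs" for k
      using that \<open>length ws = length vs\<close> dist by (simp add: map_of_zip_nth)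
    then show ?thesis using f(1) by blast
  qed
  obtain f where f: "Vector_Spaces.linear (*s) (*s) f" "\<And>k. k < length vs \<Longrightarrow> f (vs ! k) = ws ! k"
    using *[OF vs len] by blast
  obtain g where g: "Vector_Spaces.linear (*s) (*s) g" "\<And>k. k < length vs \<Longrightarrow> g (ws ! k) = vs ! k"
    using *[OF ws len[symmetric]] len by auto
  interpret f: Vector_Spaces.linear "(*s)" "(*s)" f by (fact f)
  interpret g: Vector_Spaces.linear "(*s)" "(*s)" g by (fact g)
  have gf: "g (f v) = v" if "v \<in> vec.span (set vs)" for v
    using that by (induction rule: vec.span_induct_alt)
      (auto simp: f.zero g.zero f.add g.add f.scale g.scale in_set_conv_nth f g)
  have "map f vs = ws" using f(2) len by (intro nth_equalityI) auto
  then have "f ` set vs = set ws" by (metis set_map)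
  then have img: "f ` vec.span (set vs) = vec.span (set ws)" by (simp flip: f.span_image)
  have bij: "bij_betw f (vec.span (set vs)) (vec.span (set ws))"
    unfolding bij_betw_def using img gf by (metis inj_on_def)
  have eq: "f (M *v w) = M *v f w"
    if "w \<in> vec.span (set vs)" "\<And>k. k < length vs \<Longrightarrow> f (M *v (vs ! k)) = M *v (ws ! k)" for M w
    using that(1) by (induction rule: vec.span_induct_alt)
      (auto simp: f.zero f.add f.scale in_set_conv_nth f that(2) vec.add vec.scale)
  \<comment> \<open>It suffices to check the generators on basis vectors: \<open>A\<close> has the
    same matrix \<open>B\<close> on both sides, and corresponding basis vectors have the same
    support.\<close>
  have "f (M *v u) = M *v f u" if "M \<in> terwilliger adj x" "u \<in> vec.span (set vs)" for M u
  proof (rule equivariant_terwilligerI[OF f(1) thin_module[OF vs] _ _ that])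
    show "f (adj_matrix adj *v w) = adj_matrix adj *v f w" if "w \<in> vec.span (set vs)" for w
      by (rule eq[OF that])
        (use vs ws len in \<open>auto simp: thin_basis_def represents_def f.sum f.scale f(2) intro!: sum.cong\<close>)
    show "f (Estar adj x i *v w) = Estar adj x i *v f w" if "w \<in> vec.span (set vs)" for i w
      by (rule eq[OF that]) (auto simp: thin_basis_Estar[OF vs] thin_basis_Estar[OF ws] len f f.zero)
  qed
  then show ?thesis
    unfolding module_isomorphic_def using bij f.add f.scale by blast
qed

lemma irreducible_module_eq:
  assumes "irreducible_module T W" "is_module T U" "U \<noteq> {0}" "U \<subseteq> W"
  shows "U = W"
  using assms unfolding irreducible_module_def by blast

text \<open>The vectors that generate a module with the prescribed representing matrix form the common
  kernel of two elements of $T$. The members of an orthogonal decomposition cut this kernel in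
  dimension one or zero, so its dimension counts the summands of the given type.\<close>

lemma isomorphic_summands_thin:
  assumes thin: "thin_basis adj x r B vs" and Q: "Q \<in> terwilliger adj x" "Q *v (vs ! 0) = 0"
    and ex: "\<And>v. v \<noteq> 0 \<Longrightarrow> Estar adj x r *v v = v \<Longrightarrow> Q *v v = 0 \<Longrightarrow> \<exists>ws. thin_basis adj x r B ws \<and> ws ! 0 = v"
    and dec: "orthogonal_decomposition (terwilliger adj x) Ws"
  shows "isomorphic_summands (terwilliger adj x) (vec.span (set vs)) Ws =
    vec.dim {v. Estar adj x r *v v = v \<and> Q *v v = 0}"
proof -
  let ?T = "terwilliger adj x" and ?M = "vec.span (set vs)"
  define K where "K = {v. Estar adj x r *v v = v \<and> Q *v v = 0}"
  define I where "I = {i. i < length Ws \<and> module_isomorphic ?T (Ws ! i) ?M}"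
  have irr: "irreducible_module ?T (Ws ! i)" if "i < length Ws" for i
    using dec that by (auto simp: orthogonal_decomposition_def)
  then have mod: "is_module ?T (Ws ! i)" if "i < length Ws" for i
    using that by (auto simp: irreducible_module_def)
  have sub: "vec.subspace (Ws ! i)" if "i < length Ws" for i
    using mod[OF that] by (auto simp: is_module_def)
  have orth: "hinner u v = 0" if "i < length Ws" "j < length Ws" "i \<noteq> j" "u \<in> Ws ! i" "v \<in> Ws ! j" for i j u v
    using dec that by (auto simp: orthogonal_decomposition_def)
  have ne: "vs \<noteq> []" and r: "r \<le> gdiam adj" and v0: "vs ! 0 \<noteq> 0" "Estar adj x r *v (vs ! 0) = vs ! 0"
    using thin by (auto simp: thin_basis_def pure_vector_iff)
  note Er = Estar_in_terwilliger[OF r, of x]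
  \<comment> \<open>An isomorphism from the model \<open>?M\<close> carries \<open>vs ! 0\<close> to
    a nonzero vector of \<open>K\<close> inside the summand, since it commutes with
    \<open>Estar\<close> and \<open>Q\<close>.\<close>
  have "\<exists>k. k \<in> Ws ! i \<and> k \<in> K \<and> k \<noteq> 0" if "i \<in> I" for i
  proof -
    have "module_isomorphic ?T ?M (Ws ! i)"
      using that mod by (auto simp: I_def intro: module_isomorphic_sym)
    then obtain f where f: "bij_betw f ?M (Ws ! i)" "\<And>c u. u \<in> ?M \<Longrightarrow> f (c *s u) = c *s f u"
      "\<And>C u. C \<in> ?T \<Longrightarrow> u \<in> ?M \<Longrightarrow> f (C *v u) = C *v f u"
      unfolding module_isomorphic_def by blast
    have m: "vs ! 0 \<in> ?M" using ne by (auto intro: vec.span_base)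
    have f0: "f 0 = 0" using f(2)[OF vec.span_zero, of 0] by simp
    have "f (vs ! 0) \<noteq> 0"
      using f(1) f0 m v0(1) vec.span_zero by (metis bij_betw_def inj_on_def)
    moreover have "f (vs ! 0) \<in> Ws ! i" using f(1) m by (auto simp: bij_betw_def)
    moreover have "f (vs ! 0) \<in> K"
      using f(3)[OF Er m] f(3)[OF Q(1) m] by (simp add: K_def v0 Q f0)
    ultimately show ?thesis by blast
  qed
  then obtain k where k: "\<And>i. i \<in> I \<Longrightarrow> k i \<in> Ws ! i" "\<And>i. i \<in> I \<Longrightarrow> k i \<in> K" "\<And>i. i \<in> I \<Longrightarrow> k i \<noteq> 0"
    by metis
  have korth: "hinner (k i) (k j) = 0" if "i \<in> I" "j \<in> I" "i \<noteq> j" for i j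
    using orth[OF _ _ that(3) k(1) k(1)] that by (auto simp: I_def)
  have inj: "inj_on k I" by (rule inj_onI) (metis korth k(3) hinner_self_eq_0_iff)
  have ind: "vec.independent (k ` I)"
    by (rule orthogonal_independent) (use korth k(3) in auto)
  have "K \<subseteq> vec.span (k ` I)"
  proof
    fix v assume v: "v \<in> K"
    obtain us where us: "list_all2 (\<in>) us Ws" "sum_list us = v"
      using dec unfolding orthogonal_decomposition_def by blast
    have len: "length us = length Ws" and mem: "\<And>i. i < length Ws \<Longrightarrow> us ! i \<in> Ws ! i"
      using us(1) by (auto simp: list_all2_conv_all_nth)
    \<comment> \<open>\<open>P\<close> maps each summand into itself, so the vectors
      \<open>P *v (us ! i)\<close> are again components, now of \<open>P *v v = 0\<close>.\<close>
    have ker: "P *v (us ! i) = 0" if P: "P \<in> ?T" "P *v v = 0" and i: "i < length Ws" for P i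
    proof -
      have "map ((*v) P) us ! i = 0"
      proof (rule orthogonal_sum_list_eq_0[OF _ _ orth i])
        show "list_all2 (\<in>) (map ((*v) P) us) Ws"
          using mem mod P(1) len by (auto simp: list_all2_conv_all_nth is_module_def)
        show "sum_list (map ((*v) P) us) = 0"
          using P(2) us(2) by (simp add: sum_list_sum_nth flip: vec.sum)
      qed auto
      then show ?thesis using i len by simp
    qed
    have K: "us ! i \<in> K" if "i < length Ws" for i
    proof -
      \<comment> \<open>\<open>K\<close> is the common kernel of \<open>1 - Estar adj x r\<close>
        and \<open>Q\<close>, both in \<open>T\<close>, so it contains the components of its
        members.\<close>
      have "Finite_Cartesian_Product.mat 1 - Estar adj x r \<in> ?T"
        by (intro terwilliger_diff terwilliger_one Er)
      from ker[OF this _ that] have "Estar adj x r *v (us ! i) = us ! i"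
        using v by (simp add: K_def matrix_vector_mult_diff_rdistrib)
      moreover have "Q *v (us ! i) = 0" using ker[OF Q(1) _ that] v by (simp add: K_def)
      ultimately show ?thesis by (simp add: K_def)
    qed
    have "us ! i \<in> vec.span (k ` I)" if i: "i < length Ws" for i
    proof (cases "us ! i = 0")
      case False
      \<comment> \<open>A nonzero component in \<open>K\<close> generates a thin submodule, which is
        the whole summand by irreducibility. Hence the summand has the given type and its
        \<open>Estar\<close> image is a line, shared by \<open>us ! i\<close> and
        \<open>k i\<close>.\<close>
      then obtain ws where ws: "thin_basis adj x r B ws" "ws ! 0 = us ! i"
        using ex K[OF i] by (auto simp: K_def)
      then have "ws \<noteq> []" by (simp add: thin_basis_def)
      then have "vec.span (set ws) \<subseteq> Ws ! i"
        using thin_basis_subset[OF ws(1) mod[OF i], of 0] ws(2) mem[OF i] by auto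
      moreover have "vec.span (set ws) \<noteq> {0}"
        using thin_irreducible[OF ws(1)] by (simp add: irreducible_module_def)
      ultimately have W: "vec.span (set ws) = Ws ! i"
        using irreducible_module_eq[OF irr[OF i] thin_module[OF ws(1)]] by blast
      have iI: "i \<in> I" using thin_isomorphic[OF ws(1) thin] i by (simp add: I_def W)
      have "k i \<in> Estar_image adj x r (Ws ! i)"
        using k(1,2)[OF iI] unfolding Estar_image_def K_def by (metis (mono_tags) image_eqI mem_Collect_eq)
      then have "k i \<in> vec.span {us ! i}"
        using \<open>ws \<noteq> []\<close> thin_Estar_image[OF ws(1), of r] by (simp add: W ws(2))
      then obtain c where c: "k i = c *s (us ! i)" by (auto simp: vec.span_singleton)
      then have "us ! i = inverse c *s k i" using k(3)[OF iI] by auto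
      then show ?thesis using iI by (auto intro: vec.span_scale vec.span_base)
    qed (simp add: vec.span_zero)
    then show "v \<in> vec.span (k ` I)"
      using us(2) len by (auto simp: sum_list_sum_nth intro!: vec.span_sum)
  qed
  then have "card (k ` I) = vec.dim K"
    by (rule vec.basis_card_eq_dim[rotated]) (use k(2) ind in auto)
  then show ?thesis
    using card_image[OF inj] by (simp add: isomorphic_summands_def I_def K_def)
qed

section \<open>The Petersen graph\<close>

text \<open>The pair \<open>y\<close>, \<open>z\<close> itself realizes its distance, which makes
  the constant unique and the \<open>THE\<close> in \<open>intersection_number\<close>
  meaningful.\<close>

lemma card_sphere_inter:
  assumes "distance_regular adj" "i \<le> gdiam adj" "j \<le> gdiam adj"
  shows "card (sphere_at adj i y \<inter> sphere_at adj j z) = intersection_number adj (gdist adj y z) i j"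
proof -
  obtain p where p: "\<forall>u v. gdist adj u v = gdist adj y z \<longrightarrow> card (sphere_at adj i u \<inter> sphere_at adj j v) = p"
    using assms gdist_le_gdiam[of adj y z] unfolding distance_regular_def by meson
  have "intersection_number adj (gdist adj y z) i j = p"
    unfolding intersection_number_def by (rule the_equality) (use p in auto)
  then show ?thesis using p by simp
qed

lemma
  assumes "connected_graph adj"
  shows gdist_eq_0_iff: "gdist adj y z = 0 \<longleftrightarrow> y = z"
    and gdist_eq_1_iff: "gdist adj y z = 1 \<longleftrightarrow> adj y z"
proof -
  have "adj\<^sup>*\<^sup>* y z" using assms by (simp add: connected_graph_def)
  then obtain n where "(adj ^^ n) y z" unfolding rtranclp_power by blast
  then have L: "(adj ^^ gdist adj y z) y z" unfolding gdist_def by (rule LeastI)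
  have le: "gdist adj y z \<le> n" if "(adj ^^ n) y z" for n
    unfolding gdist_def using that by (rule Least_le)
  show eq0: "gdist adj y z = 0 \<longleftrightarrow> y = z" using L le[of 0] by (cases "gdist adj y z = 0") auto
  have "y \<noteq> z" if "adj y z" using that assms by (auto simp: connected_graph_def irreflp_def)
  then show "gdist adj y z = 1 \<longleftrightarrow> adj y z" using L le[of 1] eq0
    by (cases "gdist adj y z = 1") (auto simp: eq_OO)
qed

text \<open>The length of the array gives the diameter; \<open>b_0 = 3\<close> is the valency,
  \<open>c_2 = 1\<close> gives unique common neighbours of vertices at distance two, and
  \<open>b_1 = 2\<close> excludes triangles: of the three neighbours of \<open>u\<close>, one is
  \<open>v\<close> itself, so the other two must both be at distance two from
  \<open>v\<close>.\<close>

lemma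
  assumes "petersen adj"
  shows petersen_gdiam: "gdiam adj = 2"
    and petersen_adj_sym: "adj u v \<longleftrightarrow> adj v u"
    and petersen_adj_irrefl: "\<not> adj u u"
    and petersen_gdist: "gdist adj u v = (if u = v then 0 else if adj u v then 1 else 2)"
    and petersen_valency: "card {w. adj u w} = 3"
    and petersen_no_triangle: "adj u v \<Longrightarrow> adj u w \<Longrightarrow> \<not> adj v w"
    and petersen_common_neighbour: "u \<noteq> v \<Longrightarrow> \<not> adj u v \<Longrightarrow> \<exists>!w. adj u w \<and> adj v w"
proof -
  have reg: "distance_regular adj" and con: "connected_graph adj"
    and arr: "intersection_array adj = ([3, 2], [1, 1])"
    using assms by (auto simp: petersen_def distance_regular_def)
  from arr have "length (map (\<lambda>i. intersection_number adj i 1 (i + 1)) [0..<gdiam adj]) = 2"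
    by (simp add: intersection_array_def)
  then show diam: "gdiam adj = 2" by simp
  show sym: "adj u v \<longleftrightarrow> adj v u" for u v using con by (auto simp: connected_graph_def symp_def)
  show irr: "\<not> adj u u" for u using con by (auto simp: connected_graph_def irreflp_def)
  have "gdist adj u v \<le> 2" for u v using gdist_le_gdiam[of adj u v] diam by simp
  then show dist: "gdist adj u v = (if u = v then 0 else if adj u v then 1 else 2)" for u v
    using gdist_eq_0_iff[OF con, of u v] gdist_eq_1_iff[OF con, of u v] irr[of u]
    by (metis One_nat_def le_Suc_eq le_zero_eq numeral_2_eq_2)
  have "[0..<2] = [0, 1::nat]" "[1..<3] = [1, 2::nat]" by (simp_all add: upt_rec)
  then have num: "intersection_number adj 0 1 1 = 3" "intersection_number adj 1 1 2 = 2"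
    "intersection_number adj 2 1 1 = 1"
    using arr by (auto simp: intersection_array_def diam numeral_2_eq_2)
  have S1: "sphere_at adj 1 u = {w. adj u w}" for u by (auto simp: sphere_at_def dist irr)
  have S2: "sphere_at adj 2 u = {w. w \<noteq> u \<and> \<not> adj u w}" for u by (auto simp: sphere_at_def dist irr)
  show val: "card {w. adj u w} = 3" for u
    using card_sphere_inter[OF reg, of 1 1 u u] num(1) by (simp add: diam S1[unfolded One_nat_def] dist)
  show "\<exists>!w. adj u w \<and> adj v w" if "u \<noteq> v" "\<not> adj u v" for u v
  proof -
    have "card (sphere_at adj 1 u \<inter> sphere_at adj 1 v) = 1"
      using card_sphere_inter[OF reg, of 1 1 u v] num(3) that by (simp add: diam dist)
    then have "card {w. adj u w \<and> adj v w} = 1" unfolding S1 by (simp add: Collect_conj_eq)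
    then obtain w where "{w. adj u w \<and> adj v w} = {w}" by (rule card_1_singletonE)
    then show ?thesis by (intro ex1I[of _ w]) auto
  qed
  show "\<not> adj v w" if "adj u v" "adj u w" for u v w
  proof
    assume "adj v w"
    have "card (sphere_at adj 1 u \<inter> sphere_at adj 2 v) = 2"
      using card_sphere_inter[OF reg, of 1 2 u v] num(2) that(1) irr by (auto simp: diam dist)
    moreover have "sphere_at adj 1 u \<inter> sphere_at adj 2 v \<subseteq> {y. adj u y} - {v, w}"
      using \<open>adj v w\<close> unfolding S1 S2 by auto
    moreover have "card ({y. adj u y} - {v, w}) = 1"
      using that \<open>adj v w\<close> irr[of v] val[of u] by (cases "v = w") (auto simp: card_Diff_subset)
    ultimately show False using card_mono[of "{y. adj u y} - {v, w}"] by (metis finite numeral_le_one_iff semiring_norm(69))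
  qed
qed

text \<open>Whole neighbourhoods are stated, not only edges, so that non-adjacency is decided by
  rewriting too. The hexagon runs through \<open>y1\<close>, \<open>y3\<close>, \<open>y5\<close>,
  \<open>y2\<close>, \<open>y4\<close>, \<open>y6\<close>; the two outer neighbours of each
  \<open>z\<close> are antipodal on it.\<close>

locale labelled_petersen =
  fixes adj :: "'v::finite \<Rightarrow> 'v \<Rightarrow> bool" and x z1 z2 z3 y1 y2 y3 y4 y5 y6 :: 'v
  assumes petersen: "petersen adj"
    and distinct_labels: "distinct [x, z1, z2, z3, y1, y2, y3, y4, y5, y6]"
    and adj_labels:
      "adj x v \<longleftrightarrow> v = z1 \<or> v = z2 \<or> v = z3"
      "adj z1 v \<longleftrightarrow> v = x \<or> v = y1 \<or> v = y2"
      "adj z2 v \<longleftrightarrow> v = x \<or> v = y3 \<or> v = y4"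
      "adj z3 v \<longleftrightarrow> v = x \<or> v = y5 \<or> v = y6"
      "adj y1 v \<longleftrightarrow> v = z1 \<or> v = y3 \<or> v = y6"
      "adj y2 v \<longleftrightarrow> v = z1 \<or> v = y4 \<or> v = y5"
      "adj y3 v \<longleftrightarrow> v = z2 \<or> v = y1 \<or> v = y5"
      "adj y4 v \<longleftrightarrow> v = z2 \<or> v = y2 \<or> v = y6"
      "adj y5 v \<longleftrightarrow> v = z3 \<or> v = y2 \<or> v = y3"
      "adj y6 v \<longleftrightarrow> v = z3 \<or> v = y1 \<or> v = y4"

text \<open>Fifteen edges are all that a cubic graph on ten vertices has: three known distinct
  neighbours exhaust a vertex of valency three.\<close>

lemma labelled_petersenI:
  assumes p: "petersen adj" and d: "distinct [x, z1, z2, z3, y1, y2, y3, y4, y5, y6]"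
    and edges: "adj x z1" "adj x z2" "adj x z3" "adj z1 y1" "adj z1 y2" "adj z2 y3" "adj z2 y4"
      "adj z3 y5" "adj z3 y6" "adj y1 y3" "adj y3 y5" "adj y5 y2" "adj y2 y4" "adj y4 y6" "adj y6 y1"
  shows "labelled_petersen adj x z1 z2 z3 y1 y2 y3 y4 y5 y6"
proof -
  have *: "adj u v \<longleftrightarrow> v = a \<or> v = b \<or> v = c"
    if "adj u a" "adj u b" "adj u c" "distinct [a, b, c]" for u v a b c
  proof -
    have "{a, b, c} = {w. adj u w}"
      by (rule card_subset_eq) (use that petersen_valency[OF p, of u] in auto)
    then show ?thesis by auto
  qed
  note sym = edges[THEN petersen_adj_sym[OF p, THEN iffD1]]
  show ?thesis
    by (unfold_locales, rule p, rule d) (insert edges sym d, (rule *; simp)+)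
qed

lemma second_ordering_labelling:
  assumes p: "petersen adj" and ys: "second_ordering adj x ys"
  obtains z1 z2 z3 where
    "labelled_petersen adj x z1 z2 z3 (ys ! 0) (ys ! 1) (ys ! 2) (ys ! 3) (ys ! 4) (ys ! 5)"
proof -
  note sym = petersen_adj_sym[OF p] and tri = petersen_no_triangle[OF p]
  have S1: "sphere_at adj 1 x = {w. adj x w}"
    by (auto simp: sphere_at_def petersen_gdist[OF p] petersen_adj_irrefl[OF p])
  have S2: "sphere_at adj 2 x = {w. w \<noteq> x \<and> \<not> adj x w}"
    by (auto simp: sphere_at_def petersen_gdist[OF p])
  have "length ys = 6" using ys by (simp add: second_ordering_def)
  then obtain y1 y2 y3 y4 y5 y6 where y: "ys = [y1, y2, y3, y4, y5, y6]"
    by (auto simp: numeral_eq_Suc length_Suc_conv)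
  have dy: "distinct [y1, y2, y3, y4, y5, y6]"
    and y2: "\<And>v. v \<in> {y1, y2, y3, y4, y5, y6} \<Longrightarrow> v \<noteq> x \<and> \<not> adj x v"
    using ys S2 unfolding y by (auto simp: second_ordering_def ordering_of_def)
  obtain z1 z2 z3 where z: "adj x z1" "adj z1 y1" "adj z1 y2" "adj x z2" "adj z2 y3" "adj z2 y4"
    "adj x z3" "adj z3 y5" "adj z3 y6"
    using ys S1 unfolding y by (auto simp: second_ordering_def)
  have cyc: "\<And>i j. i < 6 \<Longrightarrow> j < 6 \<Longrightarrow> adj ([y1, y3, y5, y2, y4, y6] ! i) ([y1, y3, y5, y2, y4, y6] ! j) \<longleftrightarrow>
      j = Suc i mod 6 \<or> i = Suc j mod 6"
    using ys unfolding y second_ordering_def induces_cycle_def by simp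
  have e: "adj y1 y3" "adj y3 y5" "adj y5 y2" "adj y2 y4" "adj y4 y6" "adj y6 y1"
    using cyc[of 0 1] cyc[of 1 2] cyc[of 2 3] cyc[of 3 4] cyc[of 4 5] cyc[of 5 0] by auto
  have uniq: "z = z'" if "adj x z" "adj x z'" "adj z v" "adj z' v" "v \<in> {y1, y2, y3, y4, y5, y6}" for z z' v
    using petersen_common_neighbour[OF p, of x v] y2[OF that(5)] that sym by blast
  \<comment> \<open>If two of these coincided, the ends of a hexagon edge would share a neighbour
    and form a triangle with it.\<close>
  have zz: "z1 \<noteq> z2" "z1 \<noteq> z3" "z2 \<noteq> z3"
    using tri z e by blast+
  have zy: "z \<notin> {x, y1, y2, y3, y4, y5, y6}" if "adj x z" for z
    using that y2[of z] petersen_adj_irrefl[OF p, of x] by auto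
  have "distinct [x, z1, z2, z3, y1, y2, y3, y4, y5, y6]"
    using dy zz zy[OF z(1)] zy[OF z(4)] zy[OF z(7)]
      y2[of y1] y2[of y2] y2[of y3] y2[of y4] y2[of y5] y2[of y6] by auto
  then have "labelled_petersen adj x z1 z2 z3 y1 y2 y3 y4 y5 y6"
    by (rule labelled_petersenI[OF p]) (use z e in auto)
  then show ?thesis using that y by simp
qed

lemma all_less_6: "(\<forall>i<6. P i) \<longleftrightarrow> P 0 \<and> P 1 \<and> P 2 \<and> P 3 \<and> P 4 \<and> P (5 :: nat)"
  by (simp add: numeral_eq_Suc All_less_Suc conj_ac)

context labelled_petersen
begin

lemma neq:
  "x \<noteq> z1" "x \<noteq> z2" "x \<noteq> z3" "x \<noteq> y1" "x \<noteq> y2" "x \<noteq> y3" "x \<noteq> y4" "x \<noteq> y5" "x \<noteq> y6"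
  "z1 \<noteq> z2" "z1 \<noteq> z3" "z1 \<noteq> y1" "z1 \<noteq> y2" "z1 \<noteq> y3" "z1 \<noteq> y4" "z1 \<noteq> y5" "z1 \<noteq> y6"
  "z2 \<noteq> z3" "z2 \<noteq> y1" "z2 \<noteq> y2" "z2 \<noteq> y3" "z2 \<noteq> y4" "z2 \<noteq> y5" "z2 \<noteq> y6"
  "z3 \<noteq> y1" "z3 \<noteq> y2" "z3 \<noteq> y3" "z3 \<noteq> y4" "z3 \<noteq> y5" "z3 \<noteq> y6"
  "y1 \<noteq> y2" "y1 \<noteq> y3" "y1 \<noteq> y4" "y1 \<noteq> y5" "y1 \<noteq> y6" "y2 \<noteq> y3" "y2 \<noteq> y4" "y2 \<noteq> y5" "y2 \<noteq> y6"
  "y3 \<noteq> y4" "y3 \<noteq> y5" "y3 \<noteq> y6" "y4 \<noteq> y5" "y4 \<noteq> y6" "y5 \<noteq> y6"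
  using distinct_labels by simp_all

lemmas neqs[simp] = neq neq[symmetric]

lemma UNIV_labels: "UNIV = {x, z1, z2, z3, y1, y2, y3, y4, y5, y6}"
proof -
  have "card (set [x, z1, z2, z3, y1, y2, y3, y4, y5, y6]) = CARD('v)"
    using distinct_card[OF distinct_labels] petersen by (simp add: petersen_def)
  then show ?thesis using card_subset_eq[of UNIV "set [x, z1, z2, z3, y1, y2, y3, y4, y5, y6]"] by simp
qed

lemma all_labels:
  "(\<forall>v. P v) \<longleftrightarrow> P x \<and> P z1 \<and> P z2 \<and> P z3 \<and> P y1 \<and> P y2 \<and> P y3 \<and> P y4 \<and> P y5 \<and> P y6"
  by (subst ball_UNIV[of P, symmetric]) (simp add: UNIV_labels del: ball_UNIV)

lemma sum_labels:
  "(\<Sum>v\<in>UNIV. f v) = f x + f z1 + f z2 + f z3 + f y1 + f y2 + f y3 + f y4 + f y5 + f y6"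
  by (simp add: UNIV_labels add.assoc)

lemma gdist_labels: "gdist adj u v = (if u = v then 0 else if adj u v then 1 else 2)"
  by (rule petersen_gdist[OF petersen])

lemma gdist_x:
  "gdist adj x x = 0" "gdist adj x z1 = 1" "gdist adj x z2 = 1" "gdist adj x z3 = 1"
  "gdist adj x y1 = 2" "gdist adj x y2 = 2" "gdist adj x y3 = 2" "gdist adj x y4 = 2"
  "gdist adj x y5 = 2" "gdist adj x y6 = 2"
  by (simp_all add: gdist_labels adj_labels)

lemma sphere_1: "sphere_at adj 1 x = {z1, z2, z3}"
  unfolding sphere_at_def set_eq_iff mem_Collect_eq all_labels by (simp add: gdist_x)

lemma sphere_2: "sphere_at adj 2 x = {y1, y2, y3, y4, y5, y6}"
  unfolding sphere_at_def set_eq_iff mem_Collect_eq all_labels by (simp add: gdist_x)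

lemma second_ordering_labels: "second_ordering adj x [y1, y2, y3, y4, y5, y6]"
proof -
  have l: "length [y1, y3, y5, y2, y4, y6] = 6" by simp
  have "induces_cycle adj [y1, y3, y5, y2, y4, y6]"
    unfolding induces_cycle_def l all_less_6 by (simp add: adj_labels)
  then show ?thesis
    by (auto simp: second_ordering_def ordering_of_def sphere_1[unfolded One_nat_def] sphere_2 adj_labels)
qed

end

text \<open>Beyond \<open>x\<close>, the neighbours \<open>a\<close>, \<open>b\<close>,
  \<open>c\<close> have disjoint pairs of further neighbours, and unique common neighbours give a
  perfect matching between any two pairs. Following the matchings from \<open>a\<close> to
  \<open>b\<close> to \<open>c\<close> and round again, the walk from \<open>y1\<close> cannot close
  after three steps, since that would be a triangle; so it closes after six and traces the
  hexagon.\<close>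

lemma petersen_labelling_exists:
  assumes p: "petersen adj"
  obtains z1 z2 z3 y1 y2 y3 y4 y5 y6 where "labelled_petersen adj x z1 z2 z3 y1 y2 y3 y4 y5 y6"
proof -
  note sym = petersen_adj_sym[OF p] and irr = petersen_adj_irrefl[OF p]
    and tri = petersen_no_triangle[OF p] and common = petersen_common_neighbour[OF p]
  obtain a b c where "{v. adj x v} = {a, b, c}" and abc: "a \<noteq> b" "a \<noteq> c" "b \<noteq> c"
    using petersen_valency[OF p, of x] by (auto simp: card_3_iff)
  then have Nx: "adj x v \<longleftrightarrow> v = a \<or> v = b \<or> v = c" for v by auto
  have nbrs: "\<exists>p q. p \<noteq> q \<and> p \<noteq> x \<and> q \<noteq> x \<and> (\<forall>v. adj u v \<longleftrightarrow> v = x \<or> v = p \<or> v = q)" if "adj x u" for u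
  proof -
    have "card ({v. adj u v} - {x}) = 2"
      using petersen_valency[OF p, of u] that sym by simp
    then obtain p q where "{v. adj u v} - {x} = {p, q}" "p \<noteq> q" by (auto simp: card_2_iff)
    moreover have "adj u x" using that sym by blast
    ultimately have "adj u v \<longleftrightarrow> v = x \<or> v = p \<or> v = q" for v by auto
    moreover have "p \<noteq> x" "q \<noteq> x" using \<open>{v. adj u v} - {x} = {p, q}\<close> by auto
    ultimately show ?thesis using \<open>p \<noteq> q\<close> by blast
  qed
  obtain y1 y2 where Na: "\<And>v. adj a v \<longleftrightarrow> v = x \<or> v = y1 \<or> v = y2" "y1 \<noteq> y2" "y1 \<noteq> x" "y2 \<noteq> x"
    using nbrs[of a] Nx by auto
  obtain b1 b2 where Nb: "\<And>v. adj b v \<longleftrightarrow> v = x \<or> v = b1 \<or> v = b2" "b1 \<noteq> b2" "b1 \<noteq> x" "b2 \<noteq> x"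
    using nbrs[of b] Nx by auto
  obtain c1 c2 where Nc: "\<And>v. adj c v \<longleftrightarrow> v = x \<or> v = c1 \<or> v = c2" "c1 \<noteq> c2" "c1 \<noteq> x" "c2 \<noteq> x"
    using nbrs[of c] Nx by auto
  have far: "v \<noteq> x \<Longrightarrow> adj u v \<Longrightarrow> \<not> adj x v" if "adj x u" for u v using tri that by blast
  have disj: "u = u'" if "adj x u" "adj x u'" "adj u v" "adj u' v" "v \<noteq> x" for u u' v
    using common[of x v] far[OF that(1,5,3)] that sym by blast
  \<comment> \<open>The matching: the partner of \<open>v\<close> beside \<open>u'\<close> is the
    common neighbour of \<open>v\<close> and \<open>u'\<close>, and \<open>inj\<close> states that
    it is unique.\<close>
  have step: "\<exists>w. w \<noteq> x \<and> adj u' w \<and> adj v w"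
    if "adj x u" "adj x u'" "u \<noteq> u'" "adj u v" "v \<noteq> x" for u u' v
  proof -
    have "v \<noteq> u'" using far[OF that(1,5,4)] that(2) by blast
    moreover have "\<not> adj v u'" using disj[OF that(1,2,4) _ that(5)] that(3) sym by blast
    ultimately obtain w where "adj v w" "adj u' w" using common[of v u'] by blast
    moreover have "w \<noteq> x" using far[OF that(1,5,4)] \<open>adj v w\<close> sym by blast
    ultimately show ?thesis by blast
  qed
  have inj: "w = w'" if "adj x u" "adj x u'" "u \<noteq> u'" "adj u v" "v \<noteq> x" "adj u' w" "adj v w" "adj u' w'" "adj v w'" for u u' v w w'
  proof -
    have "v \<noteq> u'" using far[OF that(1,5,4)] that(2) by blast
    moreover have "\<not> adj v u'" using disj[OF that(1,2,4) _ that(5)] that(3) sym by blast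
    ultimately show ?thesis using common[of v u'] that(6-9) by blast
  qed
  have xa: "adj x a" "adj x b" "adj x c" using Nx by auto
  obtain y3 y4 where y34: "\<And>v. adj b v \<longleftrightarrow> v = x \<or> v = y3 \<or> v = y4" "y3 \<noteq> y4" "y3 \<noteq> x" "y4 \<noteq> x" "adj y1 y3"
    using step[of a b y1] xa abc Na Nb by metis
  obtain y5 y6 where y56: "\<And>v. adj c v \<longleftrightarrow> v = x \<or> v = y5 \<or> v = y6" "y5 \<noteq> y6" "y5 \<noteq> x" "y6 \<noteq> x" "adj y3 y5"
    using step[of b c y3] xa abc y34 Nc by metis
  \<comment> \<open>The partner of \<open>y5\<close> beside \<open>a\<close> is \<open>y1\<close> or
    \<open>y2\<close>, and \<open>y1\<close> would close the triangle \<open>y1\<close>,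
    \<open>y3\<close>, \<open>y5\<close>.\<close>
  have "adj y5 y2"
    using step[of c a y5] xa abc y56 Na tri[of y3 y1 y5] y34(5) sym by metis
  \<comment> \<open>Here \<open>y3\<close> is excluded because its partner beside \<open>a\<close>
    is already \<open>y1\<close>; the next two edges follow in the same way.\<close>
  moreover have "adj y2 y4"
    using step[of a b y2] inj[of b a y3 y1 y2] xa abc y34 Na sym by metis
  moreover have "adj y4 y6"
    using step[of b c y4] inj[of c b y5 y3 y4] xa abc y34 y56 sym by metis
  moreover have "adj y6 y1"
    using step[of c a y6] inj[of a c y2 y5 y6] xa abc y56 Na \<open>adj y5 y2\<close> sym by metis
  moreover have "distinct [x, a, b, c, y1, y2, y3, y4, y5, y6]"
  proof -
    have "y1 \<notin> {a, b, c}" "y2 \<notin> {a, b, c}" "y3 \<notin> {a, b, c}" "y4 \<notin> {a, b, c}" "y5 \<notin> {a, b, c}" "y6 \<notin> {a, b, c}"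
      using far xa Na y34 y56 by blast+
    moreover have "{y1, y2} \<inter> {y3, y4} = {}" "{y1, y2} \<inter> {y5, y6} = {}" "{y3, y4} \<inter> {y5, y6} = {}"
      using disj xa abc Na y34 y56 by blast+
    moreover have "x \<notin> {a, b, c}" using xa irr by blast
    ultimately show ?thesis using abc Na(2-) y34(2-) y56(2-) by auto
  qed
  ultimately have "labelled_petersen adj x a b c y1 y2 y3 y4 y5 y6"
    by (intro labelled_petersenI[OF p]) (use xa Na y34 y56 in auto)
  then show ?thesis using that by blast
qed

section \<open>Comparing and counting thin modules\<close>

lemma thin_basis_scale:
  assumes vs: "thin_basis adj x r B vs" and "c \<noteq> 0"
  shows "thin_basis adj x r B (map ((*s) c) vs)"
proof -
  have "pure_vector adj x i (c *s v)" if "pure_vector adj x i v" for i v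
    using that assms(2) by (simp add: pure_vector_iff vec.scale)
  moreover have "represents (adj_matrix adj) (map ((*s) c) vs) B"
    using vs by (auto simp: thin_basis_def represents_def vec.scale vec.scale_sum_right
        vec.scale_left_commute intro!: sum.cong)
  ultimately show ?thesis using vs by (simp add: thin_basis_def)
qed

text \<open>The projection to the smaller endpoint annihilates one module and not the other.\<close>

lemma thin_not_isomorphic:
  assumes vs: "thin_basis adj x r B vs" and ws: "thin_basis adj x s C ws" and "r \<noteq> s"
  shows "\<not> module_isomorphic (terwilliger adj x) (vec.span (set vs)) (vec.span (set ws))"
proof -
  have *: False
    if vs: "thin_basis adj x r B vs" and ws: "thin_basis adj x s C ws" and rs: "r < s"
      and iso: "module_isomorphic (terwilliger adj x) (vec.span (set ws)) (vec.span (set vs))"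
    for r B vs s C ws
  proof -
    have "vs \<noteq> []" and r: "r \<le> gdiam adj" and v0: "vs ! 0 \<noteq> 0" "Estar adj x r *v (vs ! 0) = vs ! 0"
      using vs by (auto simp: thin_basis_def pure_vector_iff)
    have "Estar adj x r *v w = 0" if "w \<in> vec.span (set ws)" for w
    proof -
      have "Estar adj x r *v w \<in> Estar_image adj x r (vec.span (set ws))"
        using that by (auto simp: Estar_image_def)
      then show ?thesis using rs by (simp add: thin_Estar_image[OF ws])
    qed
    note module_isomorphic_kernel[OF iso Estar_in_terwilliger[OF r] this, of "vs ! 0"]
    moreover have "vs ! 0 \<in> vec.span (set vs)" using \<open>vs \<noteq> []\<close> by (auto intro: vec.span_base)
    ultimately have "Estar adj x r *v (vs ! 0) = 0" by blast
    then show False using v0 by simp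
  qed
  show ?thesis
  proof
    assume iso: "module_isomorphic (terwilliger adj x) (vec.span (set vs)) (vec.span (set ws))"
    then have "module_isomorphic (terwilliger adj x) (vec.span (set ws)) (vec.span (set vs))"
      using thin_module[OF vs] by (rule module_isomorphic_sym)
    then show False
      using *[OF vs ws] *[OF ws vs] iso assms(3) by (metis linorder_neqE_nat)
  qed
qed

text \<open>Types III and IV share endpoint and dimension, so \<open>A - \<theta>\<close> has to
  tell them apart: it kills the first line and multiplies the second by
  \<open>\<eta> - \<theta>\<close>.\<close>

lemma eigenlines_not_isomorphic:
  assumes "adj_matrix adj *v v = \<theta> *s v" "adj_matrix adj *v w = \<eta> *s w" "w \<noteq> 0" "\<theta> \<noteq> \<eta>"
  shows "\<not> module_isomorphic (terwilliger adj x) (vec.span {v}) (vec.span {w})"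
proof
  assume iso: "module_isomorphic (terwilliger adj x) (vec.span {v}) (vec.span {w})"
  let ?B = "adj_matrix adj - cmscale \<theta> (Finite_Cartesian_Product.mat 1)"
  have "?B \<in> terwilliger adj x"
    by (intro terwilliger_diff adj_matrix_in_terwilliger terwilliger_scale terwilliger_one)
  moreover have "?B *v u = 0" if "u \<in> vec.span {v}" for u
    using that assms(1)
    by (auto simp: vec.span_singleton matrix_vector_mult_diff_rdistrib cmscale_vector_mult vec.scale
        vector_smult_assoc mult.commute)
  ultimately have "?B *v w = 0"
    using module_isomorphic_kernel[OF iso] by (auto intro: vec.span_base)
  then have "(\<eta> - \<theta>) *s w = 0"
    using assms(2) by (simp add: matrix_vector_mult_diff_rdistrib cmscale_vector_mult vec.scale_left_diff_distrib)
  then show False using assms by simp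
qed

text \<open>In every decomposition the count equals the same kernel dimension, so the explicit
  \<open>Ws\<close> determines it; the dimension itself is never computed.\<close>

lemma thin_has_multiplicity:
  assumes thin: "thin_basis adj x r B vs" and Q: "Q \<in> terwilliger adj x" "Q *v (vs ! 0) = 0"
    and ex: "\<And>v. v \<noteq> 0 \<Longrightarrow> Estar adj x r *v v = v \<Longrightarrow> Q *v v = 0 \<Longrightarrow> \<exists>ws. thin_basis adj x r B ws \<and> ws ! 0 = v"
    and dec: "orthogonal_decomposition (terwilliger adj x) Ws"
    and W: "W = vec.span (set vs)"
    and m: "length (filter (\<lambda>U. module_isomorphic (terwilliger adj x) U W) Ws) = m"
  shows "has_multiplicity (terwilliger adj x) W m"
proof -
  have "isomorphic_summands (terwilliger adj x) W Ws = m"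
    using m by (simp add: isomorphic_summands_def length_filter_conv_card)
  then show ?thesis
    unfolding has_multiplicity_def W
    using dec isomorphic_summands_thin[OF thin Q ex] by (metis (no_types, lifting))
qed

lemma thin_is_seed:
  assumes vs: "thin_basis adj x r B (v # vs)"
    and "ordering_of os (sphere_at adj r x)" "essential_part os v = cs"
  shows "is_seed adj x (vec.span (set (v # vs))) os v cs"
proof -
  have "pure_vector adj x r v" using vs by (auto simp: thin_basis_def)
  then show ?thesis
    using assms(2,3) thin_Estar_image[OF vs, of r]
    unfolding is_seed_def thin_endpoint[OF vs] by simp
qed

section \<open>Eigenspaces from an orthogonal eigenbasis, and eigenvalues of the small
  matrices\<close>

lemma eigenspace_orthogonal_list:
  fixes A :: "complex^'v^'v::finite"
  assumes orth: "sorted_wrt (\<lambda>u v. hinner u v = 0) vs" and nz: "0 \<notin> set vs"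
    and len: "length vs = CARD('v)" and ev: "\<And>v. v \<in> set vs \<Longrightarrow> \<exists>\<eta>. A *v v = \<eta> *s v"
  shows "eigenspace A \<theta> = vec.span (set (filter (\<lambda>v. A *v v = \<theta> *s v) vs))"
    and "vec.dim (eigenspace A \<theta>) = length (filter (\<lambda>v. A *v v = \<theta> *s v) vs)"
proof -
  let ?F = "filter (\<lambda>v. A *v v = \<theta> *s v) vs"
  have dist: "distinct vs" and ind: "vec.independent (set vs)"
    using orthogonal_list_distinct[OF orth nz] orthogonal_list_independent[OF orth nz] by auto
  obtain \<eta> where \<eta>: "\<And>v. v \<in> set vs \<Longrightarrow> A *v v = \<eta> v *s v" using ev by metis
  show *: "eigenspace A \<theta> = vec.span (set ?F)"
  proof
    show "eigenspace A \<theta> \<subseteq> vec.span (set ?F)"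
    proof
      fix u assume u: "u \<in> eigenspace A \<theta>"
      have "u \<in> vec.span (set vs)" using orthogonal_list_span_UNIV[OF orth nz len] by simp
      then obtain c where c: "u = (\<Sum>v\<in>set vs. c v *s v)" by (auto simp: vec.span_finite)
      \<comment> \<open>\<open>A - \<theta>\<close> multiplies the coefficient at \<open>v\<close>
        by \<open>\<eta> v - \<theta>\<close>; independence forces each product to vanish, so only
        vectors with eigenvalue \<open>\<theta>\<close> survive in \<open>u\<close>.\<close>
      have "(\<Sum>v\<in>set vs. (c v * (\<eta> v - \<theta>)) *s v) = A *v u - \<theta> *s u"
        unfolding c by (simp add: vec.sum vec.scale \<eta> vec.scale_sum_right vector_smult_assoc mult_ac
            vec.scale_left_diff_distrib algebra_simps flip: sum_subtractf)
      also have "\<dots> = 0" using u by (simp add: eigenspace_def)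
      finally have "\<forall>v\<in>set vs. c v * (\<eta> v - \<theta>) = 0"
        using ind unfolding vec.independent_explicit
        by (elim conjE allE[of _ "\<lambda>v. c v * (\<eta> v - \<theta>)"]) simp
      then have "c v *s v \<in> vec.span (set ?F)" if "v \<in> set vs" for v
      proof (cases "c v = 0")
        case False
        then have "v \<in> set ?F" using that \<eta>[OF that] \<open>\<forall>v\<in>set vs. _\<close> by auto
        then show ?thesis by (intro vec.span_scale vec.span_base)
      qed (simp add: vec.span_zero)
      then show "u \<in> vec.span (set ?F)" unfolding c by (rule vec.span_sum)
    qed
    have "vec.subspace (eigenspace A \<theta>)"
      by (auto simp: vec.subspace_def eigenspace_def vec.add vec.scale vec.scale_right_distrib vector_smult_assoc mult.commute)
    then show "vec.span (set ?F) \<subseteq> eigenspace A \<theta>"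
      by (intro vec.span_minimal) (auto simp: eigenspace_def)
  qed
  have "vec.independent (set ?F)" using ind by (rule vec.independent_mono) auto
  then show "vec.dim (eigenspace A \<theta>) = length ?F"
    unfolding * using distinct_card[of ?F] dist by (simp add: vec.dim_eq_card_independent)
qed

text \<open>Coordinates as functions on \<open>nat\<close> turn the eigenvector equation into
  \<open>n\<close> scalar equations, which unfold completely for the small matrices below.\<close>

lemma eigenvalue_iff:
  assumes B: "B \<in> carrier_mat n n"
  shows "eigenvalue B \<theta> \<longleftrightarrow> (\<exists>f. (\<exists>i<n. f i \<noteq> 0) \<and> (\<forall>i<n. (\<Sum>j<n. B $$ (i, j) * f j) = \<theta> * f i))"
proof
  assume "eigenvalue B \<theta>"
  then obtain v where v: "v \<in> carrier_vec n" "v \<noteq> 0\<^sub>v n" "B *\<^sub>v v = \<theta> \<cdot>\<^sub>v v"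
    using B by (auto simp: eigenvalue_def eigenvector_def)
  have "\<exists>i<n. vec_index v i \<noteq> 0" using v(1,2) by (auto intro: Matrix.eq_vecI)
  moreover have "(\<Sum>j<n. B $$ (i, j) * vec_index v j) = \<theta> * vec_index v i" if "i < n" for i
    using arg_cong[OF v(3), of "\<lambda>w. vec_index w i"] that B v(1)
    by (simp add: scalar_prod_def atLeast0LessThan)
  ultimately show "\<exists>f. (\<exists>i<n. f i \<noteq> 0) \<and> (\<forall>i<n. (\<Sum>j<n. B $$ (i, j) * f j) = \<theta> * f i)" by blast
next
  assume "\<exists>f. (\<exists>i<n. f i \<noteq> 0) \<and> (\<forall>i<n. (\<Sum>j<n. B $$ (i, j) * f j) = \<theta> * f i)"
  then obtain f i where f: "i < n" "f i \<noteq> 0" "\<forall>i<n. (\<Sum>j<n. B $$ (i, j) * f j) = \<theta> * f i" by blast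
  have "Matrix.vec n f \<noteq> 0\<^sub>v n" using f(1,2) by (metis index_vec index_zero_vec(1))
  moreover have "B *\<^sub>v Matrix.vec n f = \<theta> \<cdot>\<^sub>v Matrix.vec n f"
    using B f(3) by (intro Matrix.eq_vecI) (auto simp: scalar_prod_def atLeast0LessThan)
  ultimately show "eigenvalue B \<theta>"
    using B by (auto simp: eigenvalue_def eigenvector_def intro!: exI[of _ "Matrix.vec n f"])
qed

lemma eigenvalues_I:
  "{\<theta>. eigenvalue (mat_of_rows_list 3 [[0, 3, 0], [1, 0, 2], [0, 1, 2]]) \<theta>} = {3, 1, -2 :: complex}"
proof -
  have "eigenvalue (mat_of_rows_list 3 [[0, 3, 0], [1, 0, 2], [0, 1, 2]]) \<theta> \<longleftrightarrow>
      (\<exists>f. (f 0 \<noteq> 0 \<or> f 1 \<noteq> 0 \<or> f (2::nat) \<noteq> 0) \<and>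
        3 * f 1 = \<theta> * f 0 \<and> f 0 + 2 * f 2 = \<theta> * f 1 \<and> f 1 + 2 * f 2 = \<theta> * f 2)" for \<theta> :: complex
    by (subst eigenvalue_iff[of _ 3])
      (auto simp: mat_of_rows_list_def numeral_eq_Suc All_less_Suc Ex_less_Suc)
  moreover have "\<theta> \<in> {3, 1, -2}"
    if f: "f 0 \<noteq> 0 \<or> f 1 \<noteq> 0 \<or> f (2::nat) \<noteq> 0" "3 * f 1 = \<theta> * f 0" "f 0 + 2 * f 2 = \<theta> * f 1"
      "f 1 + 2 * f 2 = \<theta> * f 2" for f and \<theta> :: complex
  proof -
    \<comment> \<open>Back substitution from the last row expresses \<open>f 1\<close> and
      \<open>f 0\<close> through \<open>f 2\<close>; the first row then says that the characteristic
      polynomial times \<open>f 2\<close> is zero.\<close>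
    have f1: "f 1 = (\<theta> - 2) * f 2" using f(4) by (simp add: left_diff_distrib eq_diff_eq)
    have "f 0 = \<theta> * f 1 - 2 * f 2" using f(3) by (simp add: eq_diff_eq)
    then have f0: "f 0 = (\<theta> * (\<theta> - 2) - 2) * f 2" unfolding f1 by (simp add: algebra_simps)
    have "(\<theta> - 3) * (\<theta> - 1) * (\<theta> + 2) * f 2 = \<theta> * f 0 - 3 * f 1"
      unfolding f0 f1 by (simp add: algebra_simps)
    then have "(\<theta> - 3) * (\<theta> - 1) * (\<theta> + 2) * f 2 = 0" using f(2) by simp
    moreover have "f 2 \<noteq> 0" using f(1) f1 f0 by auto
    ultimately show ?thesis by (auto simp: eq_neg_iff_add_eq_0)
  qed
  \<comment> \<open>The witness is the same back substitution, started with
    \<open>f 2 = 1\<close>.\<close>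
  moreover have "\<exists>f. (f 0 \<noteq> 0 \<or> f 1 \<noteq> 0 \<or> f (2::nat) \<noteq> 0) \<and>
        3 * f 1 = \<theta> * f 0 \<and> f 0 + 2 * f 2 = \<theta> * f 1 \<and> f 1 + 2 * f 2 = \<theta> * f 2"
    if "\<theta> \<in> {3, 1, -2}" for \<theta> :: complex
    using that
    by (intro exI[of _ "\<lambda>i. if i = 0 then \<theta> * (\<theta> - 2) - 2 else if i = 1 then \<theta> - 2 else 1"]) auto
  ultimately show ?thesis by blast
qed

lemma eigenvalues_II: "{\<theta>. eigenvalue (mat_of_rows_list 2 [[0, 2], [1, -1]]) \<theta>} = {1, -2 :: complex}"
proof -
  have "eigenvalue (mat_of_rows_list 2 [[0, 2], [1, -1]]) \<theta> \<longleftrightarrow>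
      (\<exists>f. (f 0 \<noteq> 0 \<or> f (1::nat) \<noteq> 0) \<and> 2 * f 1 = \<theta> * f 0 \<and> f 0 - f 1 = \<theta> * f 1)" for \<theta> :: complex
    by (subst eigenvalue_iff[of _ 2])
      (auto simp: mat_of_rows_list_def numeral_eq_Suc All_less_Suc Ex_less_Suc)
  moreover have "\<theta> \<in> {1, -2}"
    if f: "f 0 \<noteq> 0 \<or> f (1::nat) \<noteq> 0" "2 * f 1 = \<theta> * f 0" "f 0 - f 1 = \<theta> * f 1" for f and \<theta> :: complex
  proof -
    have f0: "f 0 = (\<theta> + 1) * f 1" using f(3) by (simp add: algebra_simps diff_eq_eq)
    have "(\<theta> - 1) * (\<theta> + 2) * f 1 = \<theta> * f 0 - 2 * f 1" unfolding f0 by (simp add: algebra_simps)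
    then have "(\<theta> - 1) * (\<theta> + 2) * f 1 = 0" using f(2) by simp
    moreover have "f 1 \<noteq> 0" using f(1) f0 by auto
    ultimately show ?thesis by (auto simp: eq_neg_iff_add_eq_0)
  qed
  moreover have "\<exists>f. (f 0 \<noteq> 0 \<or> f (1::nat) \<noteq> 0) \<and> 2 * f 1 = \<theta> * f 0 \<and> f 0 - f 1 = \<theta> * f 1"
    if "\<theta> \<in> {1, -2}" for \<theta> :: complex
    using that by (intro exI[of _ "\<lambda>i. if i = 0 then \<theta> + 1 else 1"]) auto
  ultimately show ?thesis by blast
qed

lemma eigenvalues_singleton: "{\<theta>. eigenvalue (mat_of_rows_list 1 [[a]]) \<theta>} = {a :: complex}"
proof -
  have "eigenvalue (mat_of_rows_list 1 [[a]]) \<theta> \<longleftrightarrow> (\<exists>f. f (0::nat) \<noteq> 0 \<and> a * f 0 = \<theta> * f 0)" for \<theta>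
    by (subst eigenvalue_iff[of _ 1]) (auto simp: mat_of_rows_list_def)
  then show ?thesis by (auto intro!: exI[of _ "\<lambda>_. 1"])
qed

text \<open>The inverse of \<open>essential_part\<close>: the vector with coordinates \<open>cs\<close> at the vertices \<open>vs\<close>
  and \<open>0\<close> elsewhere.\<close>

definition vector_on :: "'v list \<Rightarrow> complex list \<Rightarrow> complex^'v::finite" where
  "vector_on vs cs = (\<chi> v. case map_of (zip vs cs) v of None \<Rightarrow> 0 | Some c \<Rightarrow> c)"

lemma vector_on_nth:
  "vector_on [] cs $ v = 0"
  "vector_on (w # vs) (c # cs) $ v = (if v = w then c else vector_on vs cs $ v)"
  by (auto simp: vector_on_def)

section \<open>Modules of the four types and the spectrum in coordinates\<close>

context labelled_petersen
begin

lemma adj_matrix_vector_labels: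
  "(adj_matrix adj *v v) $ x = v $ z1 + v $ z2 + v $ z3"
  "(adj_matrix adj *v v) $ z1 = v $ x + v $ y1 + v $ y2"
  "(adj_matrix adj *v v) $ z2 = v $ x + v $ y3 + v $ y4"
  "(adj_matrix adj *v v) $ z3 = v $ x + v $ y5 + v $ y6"
  "(adj_matrix adj *v v) $ y1 = v $ z1 + v $ y3 + v $ y6"
  "(adj_matrix adj *v v) $ y2 = v $ z1 + v $ y4 + v $ y5"
  "(adj_matrix adj *v v) $ y3 = v $ z2 + v $ y1 + v $ y5"
  "(adj_matrix adj *v v) $ y4 = v $ z2 + v $ y2 + v $ y6"
  "(adj_matrix adj *v v) $ y5 = v $ z3 + v $ y2 + v $ y3"
  "(adj_matrix adj *v v) $ y6 = v $ z3 + v $ y1 + v $ y4"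
  by (simp_all add: matrix_vector_mult_def sum_labels adj_matrix_def adj_labels)

lemma vec_eq_labels: "u = v \<longleftrightarrow> u $ x = v $ x \<and> u $ z1 = v $ z1 \<and> u $ z2 = v $ z2 \<and> u $ z3 = v $ z3 \<and>
    u $ y1 = v $ y1 \<and> u $ y2 = v $ y2 \<and> u $ y3 = v $ y3 \<and> u $ y4 = v $ y4 \<and> u $ y5 = v $ y5 \<and>
    u $ y6 = v $ y6"
  unfolding vec_eq_iff by (rule all_labels)

lemma estar_nth: "estar adj x i $ v = (if gdist adj x v = i then 1 else 0)"
  by (simp add: estar_def)

lemmas label_simps = vec_eq_labels adj_matrix_vector_labels Estar_vector_mult gdist_x

text \<open>This is the primary module. Its matrix is the tridiagonal matrix of intersection
  numbers, with the \<open>b_i\<close> above, the \<open>c_i\<close> below and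
  \<open>a_i = 3 - b_i - c_i\<close> on the diagonal.\<close>

lemma thin_basis_I:
  "thin_basis adj x 0 (mat_of_rows_list 3 [[0, 3, 0], [1, 0, 2], [0, 1, 2]])
    [estar adj x 0, estar adj x 1, estar adj x 2]"
proof -
  have *: "adj_matrix adj *v estar adj x 0 = estar adj x 1"
    "adj_matrix adj *v estar adj x 1 = 3 *s estar adj x 0 + estar adj x 2"
    "adj_matrix adj *v estar adj x 2 = 2 *s estar adj x 1 + 2 *s estar adj x 2"
    by (simp_all add: label_simps estar_nth)
  have "pure_vector adj x i (estar adj x i)" if "i \<le> 2" for i
  proof -
    have "Estar adj x i *v estar adj x i = estar adj x i"
      by (simp add: vec_eq_iff Estar_vector_mult estar_nth)
    moreover have "estar adj x i \<noteq> 0"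
      using that by (auto simp: label_simps estar_nth numeral_2_eq_2 le_Suc_eq)
    ultimately show ?thesis using that by (simp add: pure_vector_iff petersen_gdiam[OF petersen])
  qed
  then show ?thesis
    unfolding thin_basis_def represents_def
    by (simp add: mat_of_rows_list_def numeral_eq_Suc All_less_Suc *[unfolded numeral_2_eq_2 One_nat_def])
qed

text \<open>The second hypothesis is the vanishing of the coordinate sum over the neighbours of
  \<open>x\<close>. Solving for the coordinate at \<open>z3\<close> leaves two free parameters,
  matching the two summands of type II.\<close>

lemma type_II_coordinates:
  assumes "Estar adj x 1 *v v = v" "Estar adj x 0 *v (adj_matrix adj *v v) = 0"
  shows "v $ x = 0" "v $ y1 = 0" "v $ y2 = 0" "v $ y3 = 0" "v $ y4 = 0" "v $ y5 = 0" "v $ y6 = 0"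
    "v $ z3 = - v $ z1 - v $ z2"
proof -
  show "v $ x = 0" "v $ y1 = 0" "v $ y2 = 0" "v $ y3 = 0" "v $ y4 = 0" "v $ y5 = 0" "v $ y6 = 0"
    using assms(1) by (simp_all add: label_simps)
  have "v $ z1 + v $ z2 + v $ z3 = 0" using assms(2) by (simp add: label_simps)
  then show "v $ z3 = - v $ z1 - v $ z2" by (simp add: add_eq_0_iff)
qed

text \<open>\<open>A v\<close> repeats the value at each \<open>z\<close> on its two hexagon
  vertices, which gives the entry \<open>2\<close>. The two hexagon neighbours of such a vertex lie
  beside the other two \<open>z\<close>, so their values sum to minus its own, which gives the
  diagonal entry \<open>-1\<close>.\<close>

lemma type_II:
  assumes v: "Estar adj x 1 *v v = v" "Estar adj x 0 *v (adj_matrix adj *v v) = 0"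
  shows "Estar adj x 2 *v (adj_matrix adj *v v) = adj_matrix adj *v v"
    and "adj_matrix adj *v (adj_matrix adj *v v) = 2 *s v - adj_matrix adj *v v"
  by (simp_all add: label_simps type_II_coordinates[OF v])

lemma thin_basis_II:
  assumes "v \<noteq> 0" and v: "Estar adj x 1 *v v = v" "Estar adj x 0 *v (adj_matrix adj *v v) = 0"
  shows "thin_basis adj x 1 (mat_of_rows_list 2 [[0, 2], [1, -1]]) [v, adj_matrix adj *v v]"
proof -
  have "adj_matrix adj *v v \<noteq> 0"
    using assms(1) type_II_coordinates[OF v] by (auto simp: vec_eq_labels adj_matrix_vector_labels)
  then show ?thesis
    using assms type_II[OF v] unfolding thin_basis_def represents_def
    by (simp add: mat_of_rows_list_def numeral_eq_Suc All_less_Suc pure_vector_iff petersen_gdiam[OF petersen])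
qed

lemma thin_basis_III_IV:
  assumes "v \<noteq> 0" "Estar adj x 2 *v v = v" "adj_matrix adj *v v = \<theta> *s v"
  shows "thin_basis adj x 2 (mat_of_rows_list 1 [[\<theta>]]) [v]"
  using assms unfolding thin_basis_def represents_def
  by (simp add: mat_of_rows_list_def pure_vector_iff petersen_gdiam[OF petersen])

lemma petersen_spectrum:
  "{\<theta>. eigenspace (adj_matrix adj) \<theta> \<noteq> {0}} = {3, 1, -2}"
  "vec.dim (eigenspace (adj_matrix adj) 3) = 1"
  "vec.dim (eigenspace (adj_matrix adj) 1) = 5"
  "vec.dim (eigenspace (adj_matrix adj) (-2)) = 4"
proof -
  define w where "w = vector_on [x, z1, z2, z3, y1, y2, y3, y4, y5, y6]"
  \<comment> \<open>These are the eigenvectors of the small matrices, expanded in the module bases: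
    \<open>e_0 + e_1 + e_2\<close>, \<open>3 e_0 + e_1 - e_2\<close> and
    \<open>6 e_0 - 4 e_1 + e_2\<close> from type I, \<open>2 \<nu> + A \<nu>\<close> and
    \<open>\<nu> - A \<nu>\<close> from type II, and the seeds of types III and IV. The
    multiplicities arise as 1, 1 + 2 + 2 and 1 + 2 + 1.\<close>
  define vs where "vs = map w
    [[1, 1, 1, 1, 1, 1, 1, 1, 1, 1],
     [3, 1, 1, 1, -1, -1, -1, -1, -1, -1],
     [0, 2, -2, 0, 1, 1, -1, -1, 0, 0],
     [0, 2, 2, -4, 1, 1, 1, 1, -2, -2],
     [0, 0, 0, 0, 1, -1, 1, -1, 0, 0],
     [0, 0, 0, 0, 1, -1, -1, 1, -2, 2],
     [6, -4, -4, -4, 1, 1, 1, 1, 1, 1],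
     [0, 1, -1, 0, -1, -1, 1, 1, 0, 0],
     [0, 1, 1, -2, -1, -1, -1, -1, 2, 2],
     [0, 0, 0, 0, 1, -1, -1, 1, 1, -1]]"
  define \<theta>s :: "complex list" where "\<theta>s = [3, 1, 1, 1, 1, 1, -2, -2, -2, -2]"
  have orth: "sorted_wrt (\<lambda>u v. hinner u v = 0) vs"
    by (simp add: vs_def w_def hinner_def sum_labels vector_on_nth)
  have nz: "0 \<notin> set vs"
    by (simp add: vs_def w_def vec_eq_labels vector_on_nth)
  have len: "length vs = CARD('v)"
    using petersen by (simp add: vs_def petersen_def)
  have ev: "list_all2 (\<lambda>\<theta> v. adj_matrix adj *v v = \<theta> *s v) \<theta>s vs"
    by (simp add: \<theta>s_def vs_def w_def vec_eq_labels adj_matrix_vector_labels vector_on_nth)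
  have ex: "\<exists>\<eta>. adj_matrix adj *v v = \<eta> *s v" if "v \<in> set vs" for v
  proof -
    obtain i where "i < length vs" "v = vs ! i" using \<open>v \<in> set vs\<close> unfolding in_set_conv_nth by blast
    then show ?thesis using ev by (auto simp: list_all2_conv_all_nth)
  qed
  \<comment> \<open>A nonzero vector has at most one eigenvalue, so the filter selects the same
    positions in \<open>vs\<close> as in \<open>\<theta>s\<close>.\<close>
  have filt: "length (filter (\<lambda>v. adj_matrix adj *v v = \<theta> *s v) vs) = length (filter (\<lambda>\<eta>. \<eta> = \<theta>) \<theta>s)" for \<theta>
    using ev nz
  proof (induction rule: list_all2_induct)
    case (Cons \<eta> \<eta>s v vs)
    have "v \<noteq> 0" using Cons by auto
    then have "adj_matrix adj *v v = \<theta> *s v \<longleftrightarrow> \<eta> = \<theta>" using Cons by simp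
    then show ?case using Cons by simp
  qed simp
  have dim: "vec.dim (eigenspace (adj_matrix adj) \<theta>) = length (filter (\<lambda>\<eta>. \<eta> = \<theta>) \<theta>s)" for \<theta>
    using eigenspace_orthogonal_list(2)[OF orth nz len ex] filt by simp
  show "vec.dim (eigenspace (adj_matrix adj) 3) = 1" "vec.dim (eigenspace (adj_matrix adj) 1) = 5"
    "vec.dim (eigenspace (adj_matrix adj) (-2)) = 4"
    unfolding dim by (simp_all add: \<theta>s_def)
  have "eigenspace (adj_matrix adj) \<theta> \<noteq> {0} \<longleftrightarrow> vec.dim (eigenspace (adj_matrix adj) \<theta>) \<noteq> 0" for \<theta>
    unfolding vec.dim_eq_0 using vec.subspace_0[of "eigenspace (adj_matrix adj) \<theta>"]
    by (auto simp: eigenspace_orthogonal_list(1)[OF orth nz len ex] vec.span_zero)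
  then show "{\<theta>. eigenspace (adj_matrix adj) \<theta> \<noteq> {0}} = {3, 1, -2}"
    unfolding dim by (auto simp: \<theta>s_def)
qed

end

section \<open>The dimension of the Terwilliger algebra\<close>

lemma Estar_nth: "Estar adj x i $ u $ v = (if u = v \<and> gdist adj x u = i then 1 else 0)"
  by (simp add: Estar_def)

lemma Estar_matrix_mult: "(Estar adj x i ** M) $ u $ v = (if gdist adj x u = i then M $ u $ v else 0)"
proof -
  have "(\<Sum>w\<in>UNIV. Estar adj x i $ u $ w * M $ w $ v) =
      (\<Sum>w\<in>UNIV. if w = u then (if gdist adj x u = i then M $ u $ v else 0) else 0)"
    by (intro sum.cong) (auto simp: Estar_def)
  then show ?thesis by (simp add: matrix_matrix_mult_def)
qed

lemma matrix_mult_add_left: "(B + C) ** M = B ** M + C ** M"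
  by (simp add: matrix_matrix_mult_def vec_eq_iff algebra_simps sum.distrib)

lemma matrix_mult_zero_left: "0 ** M = 0"
  by (simp add: matrix_matrix_mult_def vec_eq_iff)

context labelled_petersen
begin

lemma adj_matrix_mult_labels:
  "(adj_matrix adj ** M) $ x $ v = M $ z1 $ v + M $ z2 $ v + M $ z3 $ v"
  "(adj_matrix adj ** M) $ z1 $ v = M $ x $ v + M $ y1 $ v + M $ y2 $ v"
  "(adj_matrix adj ** M) $ z2 $ v = M $ x $ v + M $ y3 $ v + M $ y4 $ v"
  "(adj_matrix adj ** M) $ z3 $ v = M $ x $ v + M $ y5 $ v + M $ y6 $ v"
  "(adj_matrix adj ** M) $ y1 $ v = M $ z1 $ v + M $ y3 $ v + M $ y6 $ v"
  "(adj_matrix adj ** M) $ y2 $ v = M $ z1 $ v + M $ y4 $ v + M $ y5 $ v"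
  "(adj_matrix adj ** M) $ y3 $ v = M $ z2 $ v + M $ y1 $ v + M $ y5 $ v"
  "(adj_matrix adj ** M) $ y4 $ v = M $ z2 $ v + M $ y2 $ v + M $ y6 $ v"
  "(adj_matrix adj ** M) $ y5 $ v = M $ z3 $ v + M $ y2 $ v + M $ y3 $ v"
  "(adj_matrix adj ** M) $ y6 $ v = M $ z3 $ v + M $ y1 $ v + M $ y4 $ v"
  by (simp_all add: matrix_matrix_mult_def sum_labels adj_matrix_def adj_labels)

text \<open>The fifteen classes of \<open>cls\<close> are the orbits of the stabilizer of \<open>x\<close> on pairs of vertices;
  their indicator matrices form a basis of the Terwilliger algebra.\<close>

definition cls :: "'v \<Rightarrow> 'v \<Rightarrow> nat" where
  "cls u v =
    (if gdist adj x u = 0 then gdist adj x v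
     else if gdist adj x u = 1 then
       (if gdist adj x v = 0 then 3
        else if gdist adj x v = 1 then (if u = v then 4 else 5)
        else (if adj u v then 6 else 7))
     else
       (if gdist adj x v = 0 then 8
        else if gdist adj x v = 1 then (if adj u v then 9 else 10)
        else if u = v then 11
        else if adj u v then 12
        else if \<exists>z\<in>{z1, z2, z3}. adj z u \<and> adj z v then 13
        else 14))"

lemma cls_table:
  "map (\<lambda>u. map (cls u) [x, z1, z2, z3, y1, y2, y3, y4, y5, y6]) [x, z1, z2, z3, y1, y2, y3, y4, y5, y6] =
    [[0, 1, 1, 1, 2, 2, 2, 2, 2, 2],
     [3, 4, 5, 5, 6, 6, 7, 7, 7, 7],
     [3, 5, 4, 5, 7, 7, 6, 6, 7, 7],
     [3, 5, 5, 4, 7, 7, 7, 7, 6, 6],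
     [8, 9, 10, 10, 11, 13, 12, 14, 14, 12],
     [8, 9, 10, 10, 13, 11, 14, 12, 12, 14],
     [8, 10, 9, 10, 12, 14, 11, 13, 12, 14],
     [8, 10, 9, 10, 14, 12, 13, 11, 14, 12],
     [8, 10, 10, 9, 14, 12, 12, 14, 11, 13],
     [8, 10, 10, 9, 12, 14, 14, 12, 13, 11]]"
  by (simp add: cls_def gdist_x adj_labels)

lemmas cls_labels = cls_table[simplified]

definition orbit_matrix :: "nat \<Rightarrow> complex^'v^'v" where
  "orbit_matrix k = (\<chi> u v. if cls u v = k then 1 else 0)"

lemma orbit_matrix_nth: "orbit_matrix k $ u $ v = (if cls u v = k then 1 else 0)"
  by (simp add: orbit_matrix_def)

text \<open>Since the classes are the orbits of the stabilizer of \<open>x\<close> on pairs, this is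
  the centralizer algebra of that stabilizer.\<close>

definition orbit_algebra :: "(complex^'v^'v) set" where
  "orbit_algebra = {\<chi> u v. f (cls u v) | f. True}"

lemma orbit_algebraI: "(\<And>u v. M $ u $ v = f (cls u v)) \<Longrightarrow> M \<in> orbit_algebra"
  unfolding orbit_algebra_def by (auto simp: vec_eq_iff)

lemma orbit_algebraD: "M \<in> orbit_algebra \<Longrightarrow> \<exists>f. \<forall>u v. M $ u $ v = f (cls u v)"
  unfolding orbit_algebra_def by auto

lemma subspace_orbit_algebra: "cmat.subspace orbit_algebra"
proof (rule cmat.subspaceI)
  show "0 \<in> orbit_algebra" by (rule orbit_algebraI[of _ "\<lambda>_. 0"]) simp
next
  fix M N assume "M \<in> orbit_algebra" "N \<in> orbit_algebra"
  then obtain f g where "\<And>u v. M $ u $ v = f (cls u v)" "\<And>u v. N $ u $ v = g (cls u v)"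
    by (blast dest: orbit_algebraD)
  then show "M + N \<in> orbit_algebra" by (intro orbit_algebraI[of _ "\<lambda>k. f k + g k"]) simp
next
  fix c M assume "M \<in> orbit_algebra"
  then obtain f where "\<And>u v. M $ u $ v = f (cls u v)" by (blast dest: orbit_algebraD)
  then show "cmscale c M \<in> orbit_algebra"
    by (intro orbit_algebraI[of _ "\<lambda>k. c * f k"]) (simp add: cmscale_def)
qed

lemma adj_matrix_mult_orbit_algebra:
  assumes "M \<in> orbit_algebra"
  shows "adj_matrix adj ** M \<in> orbit_algebra"
proof -
  obtain f where f: "\<And>u v. M $ u $ v = f (cls u v)" using assms by (blast dest: orbit_algebraD)
  \<comment> \<open>Entry \<open>k\<close> sums \<open>f\<close> over the classes of
    \<open>(w, v)\<close> for the three neighbours \<open>w\<close> of \<open>u\<close>, where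
    \<open>(u, v)\<close> is any pair of class \<open>k\<close>.\<close>
  have "\<forall>u v. (adj_matrix adj ** M) $ u $ v =
    [f 3 + f 3 + f 3, f 4 + f 5 + f 5, f 6 + f 7 + f 7, f 0 + f 8 + f 8, f 1 + f 9 + f 9,
     f 1 + f 10 + f 10, f 2 + f 11 + f 13, f 2 + f 12 + f 14, f 3 + f 8 + f 8, f 4 + f 10 + f 10,
     f 5 + f 9 + f 10, f 6 + f 12 + f 12, f 7 + f 11 + f 14, f 6 + f 14 + f 14, f 7 + f 12 + f 13]
    ! cls u v"
    unfolding all_labels by (simp add: adj_matrix_mult_labels f cls_labels add_ac)
  then show ?thesis by (intro orbit_algebraI) simp
qed

lemma Estar_mult_orbit_algebra:
  assumes "M \<in> orbit_algebra"
  shows "Estar adj x i ** M \<in> orbit_algebra"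
proof -
  obtain f where f: "\<And>u v. M $ u $ v = f (cls u v)" using assms by (blast dest: orbit_algebraD)
  \<comment> \<open>The numbering goes by the sphere of the first vertex: classes 0 to 2 start at
    \<open>x\<close>, 3 to 7 in the first sphere, 8 to 14 in the second.\<close>
  have "\<forall>u v. gdist adj x u = (if cls u v < 3 then 0 else if cls u v < 8 then 1 else 2)"
    unfolding all_labels by (simp add: cls_labels gdist_x)
  then show ?thesis
    by (intro orbit_algebraI[of _ "\<lambda>k. if (if k < 3 then 0 else if k < 8 then 1 else 2) = i then f k else 0"])
      (simp add: Estar_matrix_mult f)
qed

text \<open>Left multipliers that keep \<open>orbit_algebra\<close> stable form a subalgebra, so
  checking the generators replaces checking all products of orbit matrices. Applying a multiplier to
  the identity, the sum of classes 0, 4 and 11, recovers the multiplier.\<close>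

lemma terwilliger_subset_orbit_algebra: "terwilliger adj x \<subseteq> orbit_algebra"
proof -
  let ?S = "{B. \<forall>M\<in>orbit_algebra. B ** M \<in> orbit_algebra}"
  have "matrix_subalgebra ?S"
    using subspace_orbit_algebra unfolding matrix_subalgebra_def
    by (auto simp: cmat.subspace_def cmscale_mult_left matrix_mult_add_left matrix_mult_zero_left simp flip: matrix_mul_assoc)
  then have "terwilliger adj x \<subseteq> ?S"
    by (rule terwilliger_minimal)
      (use adj_matrix_mult_orbit_algebra Estar_mult_orbit_algebra in auto)
  moreover have "\<forall>u v. (Finite_Cartesian_Product.mat 1 :: complex^'v^'v) $ u $ v =
      (if cls u v \<in> {0, 4, 11} then 1 else 0)"
    unfolding all_labels by (simp add: Finite_Cartesian_Product.mat_def cls_labels)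
  then have "Finite_Cartesian_Product.mat 1 \<in> orbit_algebra"
    by (intro orbit_algebraI[of _ "\<lambda>k. if k \<in> {0, 4, 11} then 1 else 0"]) simp
  ultimately show ?thesis by fastforce
qed

lemma cls_less: "cls u v < 15"
proof -
  have "\<forall>u v. cls u v < 15" unfolding all_labels by (simp add: cls_labels)
  then show ?thesis by blast
qed

lemma less_15: "k < 15 \<longleftrightarrow> k \<in> {0, 1, 2, 3, 4, 5, 6, 7, 8, 9, 10, 11, 12, 13, 14 :: nat}"
  by simp presburger

text \<open>Multiplying by \<open>A\<close> and then \<open>Estar\<close> counts, for
  \<open>u\<close> in a fixed sphere, the neighbours \<open>w\<close> of \<open>u\<close> with
  \<open>(w, v)\<close> in a given class. Each product is one indicator or a sum of two, one of them
  already available: going through \<open>x\<close>, for instance, reaches classes 4 and 5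
  together.\<close>

lemma orbit_matrix_products:
  "orbit_matrix 0 = Estar adj x 0"
  "orbit_matrix 4 = Estar adj x 1"
  "orbit_matrix 11 = Estar adj x 2"
  "orbit_matrix 1 = Estar adj x 0 ** (adj_matrix adj ** orbit_matrix 4)"
  "orbit_matrix 3 = Estar adj x 1 ** (adj_matrix adj ** orbit_matrix 0)"
  "orbit_matrix 6 = Estar adj x 1 ** (adj_matrix adj ** orbit_matrix 11)"
  "orbit_matrix 9 = Estar adj x 2 ** (adj_matrix adj ** orbit_matrix 4)"
  "orbit_matrix 12 = Estar adj x 2 ** (adj_matrix adj ** orbit_matrix 11)"
  "orbit_matrix 2 = Estar adj x 0 ** (adj_matrix adj ** orbit_matrix 6)"
  "orbit_matrix 8 = Estar adj x 2 ** (adj_matrix adj ** orbit_matrix 3)"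
  "orbit_matrix 5 = Estar adj x 1 ** (adj_matrix adj ** orbit_matrix 1) - orbit_matrix 4"
  "orbit_matrix 7 = Estar adj x 1 ** (adj_matrix adj ** orbit_matrix 2) - orbit_matrix 6"
  "orbit_matrix 10 = Estar adj x 2 ** (adj_matrix adj ** orbit_matrix 5)"
  "orbit_matrix 13 = Estar adj x 2 ** (adj_matrix adj ** orbit_matrix 6) - orbit_matrix 11"
  "orbit_matrix 14 = Estar adj x 2 ** (adj_matrix adj ** orbit_matrix 7) - orbit_matrix 12"
  unfolding vec_eq_iff all_labels
  by (simp_all add: Estar_matrix_mult adj_matrix_mult_labels gdist_x orbit_matrix_nth cls_labels Estar_nth)

lemma orbit_matrix_in_terwilliger:
  assumes "k < 15"
  shows "orbit_matrix k \<in> terwilliger adj x"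
proof -
  have E: "Estar adj x 0 \<in> terwilliger adj x" "Estar adj x 1 \<in> terwilliger adj x"
      "Estar adj x 2 \<in> terwilliger adj x"
    by (simp_all add: Estar_in_terwilliger petersen_gdiam[OF petersen])
  have *: "Estar adj x i ** (adj_matrix adj ** M) \<in> terwilliger adj x"
    if "Estar adj x i \<in> terwilliger adj x" "M \<in> terwilliger adj x" for i M
    using that by (intro terwilliger_mult adj_matrix_in_terwilliger)
  note o = orbit_matrix_products
  have a: "orbit_matrix 0 \<in> terwilliger adj x" "orbit_matrix 4 \<in> terwilliger adj x"
    "orbit_matrix 11 \<in> terwilliger adj x"
    using E by (simp_all only: o(1-3))
  have b: "orbit_matrix 1 \<in> terwilliger adj x" "orbit_matrix 3 \<in> terwilliger adj x"
    "orbit_matrix 6 \<in> terwilliger adj x" "orbit_matrix 9 \<in> terwilliger adj x"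
    "orbit_matrix 12 \<in> terwilliger adj x"
    unfolding o(4-8) by (intro * E a)+
  have c: "orbit_matrix 2 \<in> terwilliger adj x" "orbit_matrix 8 \<in> terwilliger adj x"
    unfolding o(9,10) by (intro * E b)+
  have d: "orbit_matrix 5 \<in> terwilliger adj x" "orbit_matrix 7 \<in> terwilliger adj x"
     "orbit_matrix 13 \<in> terwilliger adj x"
    unfolding o(11,12,14) by (intro terwilliger_diff * E a b c)+
  have e: "orbit_matrix 10 \<in> terwilliger adj x" "orbit_matrix 14 \<in> terwilliger adj x"
    unfolding o(13,15) by (intro terwilliger_diff * E b d)+
  then show ?thesis using assms a b c d e unfolding less_15 by auto
qed

lemma orbit_representative:
  assumes "k < 15"
  obtains u v where "cls u v = k"
proof -
  \<comment> \<open>The rows of \<open>x\<close>, \<open>z1\<close> and \<open>y1\<close> in the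
    class table meet all fifteen classes.\<close>
  have "cls ([x, x, x, z1, z1, z1, z1, z1, y1, y1, y1, y1, y1, y1, y1] ! k)
      ([x, z1, y1, x, z1, z2, y1, y3, x, z1, z2, y1, y3, y2, y4] ! k) = k"
    using assms unfolding less_15 by (auto simp: cls_labels)
  then show ?thesis by (rule that)
qed

lemma inj_orbit_matrix: "inj_on orbit_matrix {..<15}"
proof (rule inj_onI)
  fix j k assume "j \<in> {..<15::nat}" "orbit_matrix j = orbit_matrix k"
  moreover from this obtain u v where "cls u v = j" by (auto elim: orbit_representative)
  then have "orbit_matrix j $ u $ v = 1" "orbit_matrix k $ u $ v = (if j = k then 1 else 0)"
    by (auto simp: orbit_matrix_nth)
  ultimately show "j = k" by (metis zero_neq_one)
qed

lemma sum_cmscale_nth: "(\<Sum>k\<in>I. cmscale (c k) (F k)) $ u $ v = (\<Sum>k\<in>I. c k * F k $ u $ v)"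
  by (simp add: cmscale_def)

text \<open>The supports are disjoint and nonempty, so the entry at a representative isolates one
  coefficient.\<close>

lemma independent_orbit_matrix: "cmat.independent (orbit_matrix ` {..<15})"
proof -
  have indep: "c k = 0" if sum0: "(\<Sum>k<15. cmscale (c k) (orbit_matrix k)) = 0" and k: "k < 15" for c k
  proof -
    obtain u v where uv: "cls u v = k" using k by (rule orbit_representative)
    have "0 = (\<Sum>k<15. cmscale (c k) (orbit_matrix k)) $ u $ v" using sum0 by simp
    also have "\<dots> = (\<Sum>j<15. if j = k then c k else 0)"
      unfolding sum_cmscale_nth by (intro sum.cong) (auto simp: orbit_matrix_nth uv)
    finally show ?thesis using k by simp
  qed
  show ?thesis
  proof
    assume "cmat.dependent (orbit_matrix ` {..<15})"
    then obtain c M where "M \<in> orbit_matrix ` {..<15}" "c M \<noteq> 0"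
      "(\<Sum>M\<in>orbit_matrix ` {..<15}. cmscale (c M) M) = 0"
      by (subst (asm) cmat.dependent_finite) auto
    then show False
      using indep[of "\<lambda>k. c (orbit_matrix k)"] by (auto simp: sum.reindex[OF inj_orbit_matrix])
  qed
qed

lemma orbit_algebra_subset_span: "orbit_algebra \<subseteq> cmat.span (orbit_matrix ` {..<15})"
proof
  fix M assume "M \<in> orbit_algebra"
  then obtain f where f: "\<And>u v. M $ u $ v = f (cls u v)" by (blast dest: orbit_algebraD)
  have "(\<Sum>k<15. f k * orbit_matrix k $ u $ v) = M $ u $ v" for u v
  proof -
    have "(\<Sum>k<15. f k * orbit_matrix k $ u $ v) = (\<Sum>k<15. if k = cls u v then f (cls u v) else 0)"
      by (intro sum.cong) (auto simp: orbit_matrix_nth)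
    then show ?thesis using cls_less[of u v] by (simp add: f)
  qed
  then have "M = (\<Sum>k<15. cmscale (f k) (orbit_matrix k))"
    by (simp only: vec_eq_iff sum_cmscale_nth simp_thms)
  also have "\<dots> \<in> cmat.span (orbit_matrix ` {..<15})"
    by (intro cmat.span_sum cmat.span_scale cmat.span_base) simp
  finally show "M \<in> cmat.span (orbit_matrix ` {..<15})" .
qed

lemma dim_terwilliger: "cmat.dim (terwilliger adj x) = 15"
proof -
  have "cmat.span (orbit_matrix ` {..<15}) = cmat.span (terwilliger adj x)"
    using orbit_matrix_in_terwilliger terwilliger_subset_orbit_algebra orbit_algebra_subset_span
    by (intro cmat.span_eq[THEN iffD2] conjI) (auto intro: cmat.span_base)
  then have "cmat.dim (terwilliger adj x) = card (orbit_matrix ` {..<15})"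
    by (rule cmat.dim_eq_card) (rule independent_orbit_matrix)
  then show ?thesis by (simp add: card_image[OF inj_orbit_matrix])
qed

end

section \<open>The orthogonal decomposition for a given ordering of the first sphere\<close>

context labelled_petersen
begin

lemma ordering_of_sphere_1:
  assumes "ordering_of zs (sphere_at adj 1 x)"
  obtains p q r where "zs = [p, q, r]" "distinct [p, q, r]" "{p, q, r} = {z1, z2, z3}"
proof -
  have d: "distinct zs" and s: "set zs = {z1, z2, z3}"
    using assms by (simp_all add: ordering_of_def sphere_1[unfolded One_nat_def])
  have "length zs = 3" using distinct_card[OF d] by (simp add: s)
  then obtain p q r where "zs = [p, q, r]" by (auto simp: numeral_eq_Suc length_Suc_conv)
  then show ?thesis using that d s by auto
qed

text \<open>The given order of the first sphere need not be that of the labels: \<open>p\<close>,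
  \<open>q\<close>, \<open>r\<close> is only known to be a permutation of \<open>z1\<close>,
  \<open>z2\<close>, \<open>z3\<close>. The coordinate sum over the set is insensitive to
  this.\<close>

lemma type_II_vector_on:
  assumes "distinct [p, q, r]" "{p, q, r} = {z1, z2, z3}" "a + b + c = 0"
  shows "Estar adj x 1 *v vector_on [p, q, r] [a, b, c] = vector_on [p, q, r] [a, b, c]"
    and "Estar adj x 0 *v (adj_matrix adj *v vector_on [p, q, r] [a, b, c]) = 0"
proof -
  let ?v = "vector_on [p, q, r] [a, b, c]"
  have notin: "u \<notin> {p, q, r}" if "u \<notin> {z1, z2, z3}" for u using that assms(2) by simp
  show "Estar adj x 1 *v ?v = ?v"
    using notin[of x] notin[of y1] notin[of y2] notin[of y3] notin[of y4] notin[of y5] notin[of y6]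
    by (simp add: label_simps vector_on_nth)
  have "(\<Sum>u\<in>{z1, z2, z3}. ?v $ u) = 0"
    unfolding assms(2)[symmetric] using assms(1,3) by (auto simp: vector_on_nth add.assoc)
  then show "Estar adj x 0 *v (adj_matrix adj *v ?v) = 0"
    by (simp add: label_simps add.assoc)
qed

text \<open>Each value on the first sphere is repeated at two hexagon vertices and
  \<open>A v\<close> vanishes elsewhere, so inner products double.\<close>

lemma type_II_orthogonal:
  assumes u: "Estar adj x 1 *v u = u" "Estar adj x 0 *v (adj_matrix adj *v u) = 0"
    and v: "Estar adj x 1 *v v = v" "Estar adj x 0 *v (adj_matrix adj *v v) = 0"
    and uv: "hinner u v = 0"
  shows "hinner (adj_matrix adj *v u) (adj_matrix adj *v v) = 0"
proof -
  have "hinner (adj_matrix adj *v u) (adj_matrix adj *v v) = 2 * hinner u v"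
    by (simp add: hinner_def sum_labels adj_matrix_vector_labels type_II_coordinates[OF u]
        type_II_coordinates[OF v] algebra_simps)
  then show ?thesis using uv by simp
qed

lemma terwilliger_decomposition:
  assumes zs: "ordering_of zs (sphere_at adj 1 x)"
  defines "ys \<equiv> [y1, y2, y3, y4, y5, y6]"
  shows "\<exists>W0 W1a W1b W2a W2b W2c \<nu>1a \<nu>1b \<nu>2a \<nu>2b \<nu>2c.
          orthogonal_decomposition (terwilliger adj x) [W0, W1a, W1b, W2a, W2b, W2c] \<and>
          (\<forall>i<6. \<forall>j<6.
             module_isomorphic (terwilliger adj x)
               ([W0, W1a, W1b, W2a, W2b, W2c] ! i) ([W0, W1a, W1b, W2a, W2b, W2c] ! j) \<longleftrightarrow>
             [1, 2, 2, 3, 3, 4 :: nat] ! i = [1, 2, 2, 3, 3, 4] ! j) \<and>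
          module_data adj x W0 0 1 3 2 [1, 1, 1] \<and>
          basis_data adj x W0 [estar adj x 0, estar adj x 1, estar adj x 2]
            [[0, 3, 0], [1, 0, 2], [0, 1, 2]] {3, 1, -2} \<and>
          is_seed adj x W1a zs \<nu>1a [1, -1, 0] \<and>
          is_seed adj x W1b zs \<nu>1b [1, 1, -2] \<and>
          (\<forall>(W, \<nu>)\<in>{(W1a, \<nu>1a), (W1b, \<nu>1b)}.
             module_data adj x W 1 2 2 1 [1, 1] \<and>
             adj_matrix adj *v \<nu> = Estar adj x 2 *v (adj_matrix adj *v \<nu>) \<and>
             basis_data adj x W [\<nu>, adj_matrix adj *v \<nu>] [[0, 2], [1, -1]] {1, -2}) \<and>
          is_seed adj x W2a ys \<nu>2a [1, -1, 1, -1, 0, 0] \<and>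
          is_seed adj x W2b ys \<nu>2b [1, -1, -1, 1, -2, 2] \<and>
          (\<forall>(W, \<nu>)\<in>{(W2a, \<nu>2a), (W2b, \<nu>2b)}.
             module_data adj x W 2 2 1 0 [1] \<and>
             basis_data adj x W [\<nu>] [[1]] {1}) \<and>
          is_seed adj x W2c ys \<nu>2c [1, -1, -1, 1, 1, -1] \<and>
          module_data adj x W2c 2 1 1 0 [1] \<and>
          basis_data adj x W2c [\<nu>2c] [[-2]] {-2}"
proof -
  let ?T = "terwilliger adj x" and ?A = "adj_matrix adj"
  obtain p q r where pqr: "zs = [p, q, r]" "distinct [p, q, r]" "{p, q, r} = {z1, z2, z3}"
    using zs by (rule ordering_of_sphere_1)
  define e0 e1 e2 where "e0 = estar adj x 0" and "e1 = estar adj x 1" and "e2 = estar adj x 2"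
  define n1a n1b where "n1a = vector_on zs [1, -1, 0]" and "n1b = vector_on zs [1, 1, -2]"
  define n2a n2b n2c where "n2a = vector_on ys [1, -1, 1, -1, 0, 0]"
    and "n2b = vector_on ys [1, -1, -1, 1, -2, 2]" and "n2c = vector_on ys [1, -1, -1, 1, 1, -1]"
  note n2_nth = n2a_def n2b_def n2c_def ys_def vector_on_nth
  have n1a: "Estar adj x 1 *v n1a = n1a" "Estar adj x 0 *v (?A *v n1a) = 0"
    and n1b: "Estar adj x 1 *v n1b = n1b" "Estar adj x 0 *v (?A *v n1b) = 0"
    unfolding n1a_def n1b_def pqr(1) by (rule type_II_vector_on[OF pqr(2,3)]; simp)+
  have ess1: "essential_part zs n1a = [1, -1, 0]" "essential_part zs n1b = [1, 1, -2]"
    using pqr(2) by (auto simp: essential_part_def n1a_def n1b_def pqr(1) vector_on_nth)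
  have ess2: "essential_part ys n2a = [1, -1, 1, -1, 0, 0]" "essential_part ys n2b = [1, -1, -1, 1, -2, 2]"
    "essential_part ys n2c = [1, -1, -1, 1, 1, -1]"
    by (simp_all add: essential_part_def n2_nth)
  have nz1: "n1a \<noteq> 0" "n1b \<noteq> 0"
    using ess1 by (auto simp: essential_part_def pqr(1))
  have nz2: "n2a \<noteq> 0" "n2b \<noteq> 0" "n2c \<noteq> 0"
    using ess2 by (auto simp: essential_part_def ys_def)
  have n2: "Estar adj x 2 *v n2a = n2a" "Estar adj x 2 *v n2b = n2b" "Estar adj x 2 *v n2c = n2c"
    by (simp_all add: label_simps n2_nth)
  have An2: "?A *v n2a = 1 *s n2a" "?A *v n2b = 1 *s n2b" "?A *v n2c = -2 *s n2c"
    by (simp_all add: vec_eq_labels adj_matrix_vector_labels n2_nth)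
  have t0: "thin_basis adj x 0 (mat_of_rows_list 3 [[0, 3, 0], [1, 0, 2], [0, 1, 2]]) [e0, e1, e2]"
    unfolding e0_def e1_def e2_def by (rule thin_basis_I)
  note t1a = thin_basis_II[OF nz1(1) n1a] and t1b = thin_basis_II[OF nz1(2) n1b]
  note t2a = thin_basis_III_IV[OF nz2(1) n2(1) An2(1)] and t2b = thin_basis_III_IV[OF nz2(2) n2(2) An2(2)]
    and t2c = thin_basis_III_IV[OF nz2(3) n2(3) An2(3)]
  define W0 W1a W1b W2a W2b W2c where W: "W0 = vec.span (set [e0, e1, e2])"
    "W1a = vec.span (set [n1a, ?A *v n1a])" "W1b = vec.span (set [n1b, ?A *v n1b])"
    "W2a = vec.span (set [n2a])" "W2b = vec.span (set [n2b])" "W2c = vec.span (set [n2c])"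
  let ?Ws = "[W0, W1a, W1b, W2a, W2b, W2c]"
  have dec: "orthogonal_decomposition ?T ?Ws"
  proof -
    let ?bs = "[[e0, e1, e2], [n1a, ?A *v n1a], [n1b, ?A *v n1b], [n2a], [n2b], [n2c]]"
    have "orthogonal_decomposition ?T (map (\<lambda>vs. vec.span (set vs)) ?bs)"
    proof (rule orthogonal_decompositionI)
      show "irreducible_module ?T (vec.span (set vs))" if "vs \<in> set ?bs" for vs
        using that t0 t1a t1b t2a t2b t2c by (auto dest: thin_irreducible)
      \<comment> \<open>The seeds are known in the order \<open>p\<close>, \<open>q\<close>,
        \<open>r\<close>, so the sum is moved to that description of the set, where it is
        \<open>1 - 1 + 0\<close>.\<close>
      have "hinner n1a n1b = (\<Sum>u\<in>{z1, z2, z3}. n1a $ u * cnj (n1b $ u))"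
        by (simp add: hinner_def sum_labels type_II_coordinates[OF n1a] type_II_coordinates[OF n1b] add.assoc)
      also have "\<dots> = 0"
        unfolding pqr(3)[symmetric] using pqr(2) by (auto simp: n1a_def n1b_def pqr(1) vector_on_nth)
      finally have h: "hinner n1a n1b = 0" .
      note h' = type_II_orthogonal[OF n1a n1b h]
      note coord = e0_def e1_def e2_def estar_nth n2_nth type_II_coordinates[OF n1a]
        type_II_coordinates[OF n1b] adj_matrix_vector_labels gdist_x
      show "sorted_wrt (\<lambda>u v. hinner u v = 0) (concat ?bs)"
        by (simp add: h h') (simp add: hinner_def sum_labels coord)
      have "0 \<notin> set [e0, e1, e2]" "0 \<notin> set [n1a, ?A *v n1a]" "0 \<notin> set [n1b, ?A *v n1b]"
        using thin_basis_orthogonal(2)[OF t0] thin_basis_orthogonal(2)[OF t1a] thin_basis_orthogonal(2)[OF t1b]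
        by blast+
      then show "0 \<notin> set (concat ?bs)" using nz2 by auto
      show "length (concat ?bs) = CARD('v)" using petersen by (simp add: petersen_def)
    qed
    then show ?thesis by (simp add: W)
  qed
  have iso: "\<forall>i<6. \<forall>j<6. module_isomorphic ?T (?Ws ! i) (?Ws ! j) \<longleftrightarrow>
      [1, 2, 2, 3, 3, 4 :: nat] ! i = [1, 2, 2, 3, 3, 4] ! j"
  proof -
    have same: "module_isomorphic ?T W1a W1b" "module_isomorphic ?T W1b W1a"
      "module_isomorphic ?T W2a W2b" "module_isomorphic ?T W2b W2a"
      unfolding W using t1a t1b t2a t2b by (blast intro: thin_isomorphic)+
    have ni: "\<not> module_isomorphic ?T U V \<and> \<not> module_isomorphic ?T V U"
      if "thin_basis adj x r B vs" "thin_basis adj x s C ws" "U = vec.span (set vs)" "V = vec.span (set ws)" "r \<noteq> s"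
      for r B vs s C ws U V
      using that by (metis thin_not_isomorphic)
    note d0 = ni[OF t0 t1a W(1,2)] ni[OF t0 t1b W(1,3)] ni[OF t0 t2a W(1,4)]
      ni[OF t0 t2b W(1,5)] ni[OF t0 t2c W(1,6)]
    note d1 = ni[OF t1a t2a W(2,4)] ni[OF t1a t2b W(2,5)] ni[OF t1a t2c W(2,6)]
      ni[OF t1b t2a W(3,4)] ni[OF t1b t2b W(3,5)] ni[OF t1b t2c W(3,6)]
    have d2: "\<not> module_isomorphic ?T W2a W2c" "\<not> module_isomorphic ?T W2b W2c"
      "\<not> module_isomorphic ?T W2c W2a" "\<not> module_isomorphic ?T W2c W2b"
      unfolding W
      using eigenlines_not_isomorphic[OF An2(1) An2(3) nz2(3), of x]
        eigenlines_not_isomorphic[OF An2(2) An2(3) nz2(3), of x]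
        eigenlines_not_isomorphic[OF An2(3) An2(1) nz2(1), of x]
        eigenlines_not_isomorphic[OF An2(3) An2(2) nz2(2), of x]
      by simp_all
    show ?thesis
      unfolding all_less_6 by (simp add: module_isomorphic_refl same d0 d1 d2)
  qed
  note table = iso[unfolded all_less_6, simplified]
  have dm: "gdiam adj = 2" by (rule petersen_gdiam[OF petersen])
  \<comment> \<open>\<open>Q = 0\<close> suffices because \<open>E_0^* V\<close> is the line of
    \<open>e0\<close>: a scaled copy of the basis starts at any given nonzero vector of it.\<close>
  have m0: "has_multiplicity ?T W0 1"
  proof (rule thin_has_multiplicity[OF t0 terwilliger_zero _ _ dec W(1)])
    fix v :: "complex^'v" assume v: "v \<noteq> 0" "Estar adj x 0 *v v = v"
    have "v = v $ x *s e0" using v(2) by (simp add: label_simps e0_def estar_nth)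
    moreover from this have "v $ x \<noteq> 0" using v(1) by auto
    ultimately show "\<exists>ws. thin_basis adj x 0 (mat_of_rows_list 3 [[0, 3, 0], [1, 0, 2], [0, 1, 2]]) ws \<and> ws ! 0 = v"
      by (intro exI[of _ "map ((*s) (v $ x)) [e0, e1, e2]"] conjI thin_basis_scale[OF t0]) simp_all
  qed (simp_all add: table)
  have m1: "has_multiplicity ?T W1a 2" "has_multiplicity ?T W1b 2"
  proof -
    \<comment> \<open>Its kernel on the first sphere is the zero-sum condition, which makes every
      nonzero vector there a type II seed.\<close>
    have Q: "Estar adj x 0 ** ?A \<in> ?T"
      by (simp add: terwilliger_mult adj_matrix_in_terwilliger Estar_in_terwilliger)
    have ex: "\<exists>ws. thin_basis adj x 1 (mat_of_rows_list 2 [[0, 2], [1, -1]]) ws \<and> ws ! 0 = v"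
      if "v \<noteq> 0" "Estar adj x 1 *v v = v" "(Estar adj x 0 ** ?A) *v v = 0" for v
      using thin_basis_II[OF that(1,2)] that(3)
      by (intro exI[of _ "[v, ?A *v v]"]) (simp flip: matrix_vector_mul_assoc)
    show "has_multiplicity ?T W1a 2"
      by (rule thin_has_multiplicity[OF t1a Q _ ex dec W(2)])
        (simp_all add: table n1a flip: matrix_vector_mul_assoc)
    show "has_multiplicity ?T W1b 2"
      by (rule thin_has_multiplicity[OF t1b Q _ ex dec W(3)])
        (simp_all add: table n1b flip: matrix_vector_mul_assoc)
  qed
  have mult: "has_multiplicity ?T U m"
    if v: "v \<noteq> 0" "Estar adj x 2 *v v = v" "?A *v v = \<theta> *s v" and U: "U = vec.span (set [v])"
      and m: "length (filter (\<lambda>V. module_isomorphic ?T V U) ?Ws) = m" for v \<theta> U m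
  proof -
    \<comment> \<open>A nonzero vector on the second sphere spans a module with matrix
      \<open>[[\<theta>]]\<close> as soon as it is an eigenvector of \<open>A\<close> for
      \<open>\<theta>\<close>.\<close>
    let ?Q = "?A - cmscale \<theta> (Finite_Cartesian_Product.mat 1)"
    have Q: "?Q \<in> ?T"
      by (intro terwilliger_diff adj_matrix_in_terwilliger terwilliger_scale terwilliger_one)
    have Qu: "?Q *v u = ?A *v u - \<theta> *s u" for u
      by (simp add: matrix_vector_mult_diff_rdistrib cmscale_vector_mult)
    have ex: "\<exists>ws. thin_basis adj x 2 (mat_of_rows_list 1 [[\<theta>]]) ws \<and> ws ! 0 = u"
      if "u \<noteq> 0" "Estar adj x 2 *v u = u" "?Q *v u = 0" for u
      using thin_basis_III_IV[OF that(1,2), of \<theta>] that(3) by (intro exI[of _ "[u]"]) (simp add: Qu)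
    show ?thesis
      by (rule thin_has_multiplicity[OF thin_basis_III_IV[OF v] Q _ ex dec U m]) (simp_all add: Qu v)
  qed
  have m2: "has_multiplicity ?T W2a 2" "has_multiplicity ?T W2b 2" "has_multiplicity ?T W2c 1"
    using mult[OF nz2(1) n2(1) An2(1) W(4)] mult[OF nz2(2) n2(2) An2(2) W(5)]
      mult[OF nz2(3) n2(3) An2(3) W(6)] by (simp_all add: table numeral_2_eq_2)
  have data: "module_data adj x (vec.span (set vs)) r m (length vs) (length vs - 1) (replicate (length vs) 1)"
    if "thin_basis adj x r B vs" "has_multiplicity ?T (vec.span (set vs)) m" for r B vs m
    unfolding module_data_def using that thin_endpoint thin_dim thin_diam thin_shape by blast
  have basis: "basis_data adj x (vec.span (set vs)) vs rs evs"
    if "thin_basis adj x r (mat_of_rows_list (length vs) rs) vs"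
      "{\<theta>. eigenvalue (mat_of_rows_list (length vs) rs) \<theta>} = evs" for r vs rs evs
    unfolding basis_data_def using that thin_pure_basis[OF that(1)] by (simp add: thin_basis_def)
  have len: "length [a, b, c] = 3" "length [a, b] = 2" "length [a] = 1" for a b c :: "complex^'v"
    by simp_all
  have data0: "module_data adj x W0 0 1 3 2 [1, 1, 1]"
    and data1: "module_data adj x W1a 1 2 2 1 [1, 1]" "module_data adj x W1b 1 2 2 1 [1, 1]"
    and data2: "module_data adj x W2a 2 2 1 0 [1]" "module_data adj x W2b 2 2 1 0 [1]"
      "module_data adj x W2c 2 1 1 0 [1]"
    using data[OF t0 m0[unfolded W]] data[OF t1a m1(1)[unfolded W]] data[OF t1b m1(2)[unfolded W]]
      data[OF t2a m2(1)[unfolded W]] data[OF t2b m2(2)[unfolded W]] data[OF t2c m2(3)[unfolded W]]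
    by (simp_all add: W numeral_eq_Suc)
  have basis0: "basis_data adj x W0 [estar adj x 0, estar adj x 1, estar adj x 2]
      [[0, 3, 0], [1, 0, 2], [0, 1, 2]] {3, 1, -2}"
    unfolding W(1) e0_def[symmetric] e1_def[symmetric] e2_def[symmetric]
    by (rule basis, unfold len, rule t0, rule eigenvalues_I)
  have basis1: "basis_data adj x W1a [n1a, ?A *v n1a] [[0, 2], [1, -1]] {1, -2}" unfolding W(2)
    by (rule basis, unfold len, rule t1a, rule eigenvalues_II)
  have basis1': "basis_data adj x W1b [n1b, ?A *v n1b] [[0, 2], [1, -1]] {1, -2}" unfolding W(3)
    by (rule basis, unfold len, rule t1b, rule eigenvalues_II)
  have basis2: "basis_data adj x W2a [n2a] [[1]] {1}" unfolding W(4)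
    by (rule basis, unfold len, rule t2a, rule eigenvalues_singleton)
  have basis2': "basis_data adj x W2b [n2b] [[1]] {1}" unfolding W(5)
    by (rule basis, unfold len, rule t2b, rule eigenvalues_singleton)
  have basis3: "basis_data adj x W2c [n2c] [[-2]] {-2}" unfolding W(6)
    by (rule basis, unfold len, rule t2c, rule eigenvalues_singleton)
  have seed1: "is_seed adj x W1a zs n1a [1, -1, 0]" unfolding W(2) by (rule thin_is_seed[OF t1a zs ess1(1)])
  have seed1': "is_seed adj x W1b zs n1b [1, 1, -2]" unfolding W(3) by (rule thin_is_seed[OF t1b zs ess1(2)])
  have ys: "ordering_of ys (sphere_at adj 2 x)" by (simp add: ordering_of_def ys_def sphere_2)
  have seed2: "is_seed adj x W2a ys n2a [1, -1, 1, -1, 0, 0]" unfolding W(4) by (rule thin_is_seed[OF t2a ys ess2(1)])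
  have seed2': "is_seed adj x W2b ys n2b [1, -1, -1, 1, -2, 2]" unfolding W(5) by (rule thin_is_seed[OF t2b ys ess2(2)])
  have seed3: "is_seed adj x W2c ys n2c [1, -1, -1, 1, 1, -1]" unfolding W(6) by (rule thin_is_seed[OF t2c ys ess2(3)])
  have II: "\<forall>(W, \<nu>)\<in>{(W1a, n1a), (W1b, n1b)}.
      module_data adj x W 1 2 2 1 [1, 1] \<and> ?A *v \<nu> = Estar adj x 2 *v (?A *v \<nu>) \<and>
      basis_data adj x W [\<nu>, ?A *v \<nu>] [[0, 2], [1, -1]] {1, -2}"
    unfolding ball_simps case_prod_conv
    by (intro conjI TrueI; fact data1 basis1 basis1' type_II(1)[OF n1a, symmetric] type_II(1)[OF n1b, symmetric])
  have III: "\<forall>(W, \<nu>)\<in>{(W2a, n2a), (W2b, n2b)}.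
      module_data adj x W 2 2 1 0 [1] \<and> basis_data adj x W [\<nu>] [[1]] {1}"
    unfolding ball_simps case_prod_conv by (intro conjI TrueI; fact data2 basis2 basis2')
  show ?thesis
    by (rule exI[of _ W0], rule exI[of _ W1a], rule exI[of _ W1b], rule exI[of _ W2a], rule exI[of _ W2b],
        rule exI[of _ W2c], rule exI[of _ n1a], rule exI[of _ n1b], rule exI[of _ n2a],
        rule exI[of _ n2b], rule exI[of _ n2c], intro conjI)
      (fact dec iso data0 basis0 seed1 seed1' II seed2 seed2' III seed3 data2 basis3)+
qed

end

theorem mainTheorem3:
  fixes adj :: "'v::finite \<Rightarrow> 'v \<Rightarrow> bool" and x :: 'v
  assumes "petersen adj"
  shows
    "{\<theta>. eigenspace (adj_matrix adj) \<theta> \<noteq> {0}} = {3, 1, -2} \<and>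
     vec.dim (eigenspace (adj_matrix adj) 3) = 1 \<and>
     vec.dim (eigenspace (adj_matrix adj) 1) = 5 \<and>
     vec.dim (eigenspace (adj_matrix adj) (-2)) = 4 \<and>
     card (sphere_at adj 1 x) = 3 \<and>
     (\<exists>ys. second_ordering adj x ys) \<and>
     (\<forall>zs ys. ordering_of zs (sphere_at adj 1 x) \<longrightarrow> second_ordering adj x ys \<longrightarrow>
       (\<exists>W0 W1a W1b W2a W2b W2c \<nu>1a \<nu>1b \<nu>2a \<nu>2b \<nu>2c.
          orthogonal_decomposition (terwilliger adj x) [W0, W1a, W1b, W2a, W2b, W2c] \<and>
          (\<forall>i<6. \<forall>j<6.
             module_isomorphic (terwilliger adj x)
               ([W0, W1a, W1b, W2a, W2b, W2c] ! i) ([W0, W1a, W1b, W2a, W2b, W2c] ! j) \<longleftrightarrow>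
             [1, 2, 2, 3, 3, 4 :: nat] ! i = [1, 2, 2, 3, 3, 4] ! j) \<and>
          \<comment> \<open>Type I\<close>
          module_data adj x W0 0 1 3 2 [1, 1, 1] \<and>
          basis_data adj x W0 [estar adj x 0, estar adj x 1, estar adj x 2]
            [[0, 3, 0], [1, 0, 2], [0, 1, 2]] {3, 1, -2} \<and>
          \<comment> \<open>Type II\<close>
          is_seed adj x W1a zs \<nu>1a [1, -1, 0] \<and>
          is_seed adj x W1b zs \<nu>1b [1, 1, -2] \<and>
          (\<forall>(W, \<nu>)\<in>{(W1a, \<nu>1a), (W1b, \<nu>1b)}.
             module_data adj x W 1 2 2 1 [1, 1] \<and>
             adj_matrix adj *v \<nu> = Estar adj x 2 *v (adj_matrix adj *v \<nu>) \<and>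
             basis_data adj x W [\<nu>, adj_matrix adj *v \<nu>] [[0, 2], [1, -1]] {1, -2}) \<and>
          \<comment> \<open>Type III\<close>
          is_seed adj x W2a ys \<nu>2a [1, -1, 1, -1, 0, 0] \<and>
          is_seed adj x W2b ys \<nu>2b [1, -1, -1, 1, -2, 2] \<and>
          (\<forall>(W, \<nu>)\<in>{(W2a, \<nu>2a), (W2b, \<nu>2b)}.
             module_data adj x W 2 2 1 0 [1] \<and>
             basis_data adj x W [\<nu>] [[1]] {1}) \<and>
          \<comment> \<open>Type IV\<close>
          is_seed adj x W2c ys \<nu>2c [1, -1, -1, 1, 1, -1] \<and>
          module_data adj x W2c 2 1 1 0 [1] \<and>
          basis_data adj x W2c [\<nu>2c] [[-2]] {-2})) \<and>
     cmat.dim (terwilliger adj x) = 3^2 + 2^2 + 1^2 + 1^2 \<and>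
     cmat.dim (terwilliger adj x) = 15"
proof -
  have p: "petersen adj" by (fact assms)
  \<comment> \<open>This labelling serves the claims that refer to no given ordering: spectrum,
    valency, existence of an ordering, and dimension.\<close>
  obtain z1 z2 z3 y1 y2 y3 y4 y5 y6 where L: "labelled_petersen adj x z1 z2 z3 y1 y2 y3 y4 y5 y6"
    using p by (rule petersen_labelling_exists)
  interpret L: labelled_petersen adj x z1 z2 z3 y1 y2 y3 y4 y5 y6 by (fact L)
  have card: "card (sphere_at adj 1 x) = 3"
    using L.distinct_labels by (simp add: L.sphere_1[unfolded One_nat_def])
  have ys: "\<exists>ys. second_ordering adj x ys" using L.second_ordering_labels by blast
  have dim: "cmat.dim (terwilliger adj x) = 3^2 + 2^2 + 1^2 + 1^2" by (simp add: L.dim_terwilliger)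
  show ?thesis
  proof (intro conjI allI impI)
    fix zs ys assume zs: "ordering_of zs (sphere_at adj 1 x)" and ys: "second_ordering adj x ys"
    \<comment> \<open>A second labelling is built on the prescribed hexagon \<open>ys\<close>; its
      labels on the first sphere are chosen independently of \<open>zs\<close>.\<close>
    obtain w1 w2 w3 where M: "labelled_petersen adj x w1 w2 w3 (ys ! 0) (ys ! 1) (ys ! 2) (ys ! 3) (ys ! 4) (ys ! 5)"
      using p ys by (rule second_ordering_labelling)
    have ys_eq: "[ys ! 0, ys ! 1, ys ! 2, ys ! 3, ys ! 4, ys ! 5] = ys"
      using ys by (intro nth_equalityI) (auto simp: second_ordering_def numeral_eq_Suc less_Suc_eq)
    show "\<exists>W0 W1a W1b W2a W2b W2c \<nu>1a \<nu>1b \<nu>2a \<nu>2b \<nu>2c.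
          orthogonal_decomposition (terwilliger adj x) [W0, W1a, W1b, W2a, W2b, W2c] \<and>
          (\<forall>i<6. \<forall>j<6.
             module_isomorphic (terwilliger adj x)
               ([W0, W1a, W1b, W2a, W2b, W2c] ! i) ([W0, W1a, W1b, W2a, W2b, W2c] ! j) \<longleftrightarrow>
             [1, 2, 2, 3, 3, 4 :: nat] ! i = [1, 2, 2, 3, 3, 4] ! j) \<and>
          module_data adj x W0 0 1 3 2 [1, 1, 1] \<and>
          basis_data adj x W0 [estar adj x 0, estar adj x 1, estar adj x 2]
            [[0, 3, 0], [1, 0, 2], [0, 1, 2]] {3, 1, -2} \<and>
          is_seed adj x W1a zs \<nu>1a [1, -1, 0] \<and>
          is_seed adj x W1b zs \<nu>1b [1, 1, -2] \<and>
          (\<forall>(W, \<nu>)\<in>{(W1a, \<nu>1a), (W1b, \<nu>1b)}.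
             module_data adj x W 1 2 2 1 [1, 1] \<and>
             adj_matrix adj *v \<nu> = Estar adj x 2 *v (adj_matrix adj *v \<nu>) \<and>
             basis_data adj x W [\<nu>, adj_matrix adj *v \<nu>] [[0, 2], [1, -1]] {1, -2}) \<and>
          is_seed adj x W2a ys \<nu>2a [1, -1, 1, -1, 0, 0] \<and>
          is_seed adj x W2b ys \<nu>2b [1, -1, -1, 1, -2, 2] \<and>
          (\<forall>(W, \<nu>)\<in>{(W2a, \<nu>2a), (W2b, \<nu>2b)}.
             module_data adj x W 2 2 1 0 [1] \<and>
             basis_data adj x W [\<nu>] [[1]] {1}) \<and>
          is_seed adj x W2c ys \<nu>2c [1, -1, -1, 1, 1, -1] \<and>
          module_data adj x W2c 2 1 1 0 [1] \<and>
          basis_data adj x W2c [\<nu>2c] [[-2]] {-2}"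
      by (rule labelled_petersen.terwilliger_decomposition[OF M zs, unfolded ys_eq])
  qed (fact L.petersen_spectrum card ys dim L.dim_terwilliger)+
qed

end
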